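(* Let $U$ be a solution of either the $hp$-cG scheme or the $hp$-dG scheme (both defined in the context) for the initial value problem $u'(t)=\mathcal F(t,u(t))$, $u(0)=u_0$, on $(0,T)$, and let $\widehat e_m=u-\widehat U_m$ be the reconstruction error, where $u$ is the exact solution. For any $m\ge 1$ (with $m\le M$), if $\delta_1,\dots,\delta_m$ exist, then $$\|\widehat e_m\|_{L^\infty(I_m;H)}\le \delta_m\,\psi_m .$$
   Context: Setting. $H$ is a real Hilbert space with inner product $(\cdot,\cdot)_H$ and norm $\|\cdot\|_H$; $T>0$, $u_0\in H$. The map $\mathcal F:[0,T]\times H\to H$ satisfies: $\mathcal F(\cdot,v)$ is strongly measurable for each $v\in H$, $\mathcal F(\cdot,0)\in L^1((0,T);H)$, and $$\|\mathcal F(t,v)-\mathcal F(t,w)\|_H\le \mathcal L(t,\|v\|_H,\|w\|_H)\,\|v-w\|_H\qquad\forall t\in[0,T],\ \forall v,w\in H,$$ where $\mathcal L:[0,T]\times\mathbb R_0^+\times\mathbb R_0^+\to\mathbb R_0^+$ is a known function with $\mathcal L(\cdot,a,b)\in L^1((0,T))$ for all $a,b\ge0$, continuous and monotone increasing in its second and third arguments. $u\in C([0,T];H)$ denotes the unique solution, i.e. $u(t)=u_0+\int_0^t\mathcal F(s,u(s))\,ds$ for $t\in[0,T]$. Discretization. $0=t_0<t_1<\dots<t_M=T$, $I_m=(t_{m-1},t_m)$, $k_m=t_m-t_{m-1}$. To each $I_m$ are associated a polynomial degree $r_m\in\mathbb N_0$ ($r_m\ge1$ for the cG scheme) and a finite-dimensional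 subspace $H_m\subset H$; $\pi_m:H\to H_m$ is the $H$-orthogonal projection. $\mathcal P^r(I_m;H_m)$ is the space of polynomials in $t$ of degree at most $r$ on $I_m$ with coefficients in $H_m$, and $\Pi_m^{r}$ is the $L^2$-projection onto it: $\Pi_m^r f\in\mathcal P^r(I_m;H_m)$ and $\int_{I_m}(\Pi^r_mf-f,V)_H\,dt=0$ for all $V\in\mathcal P^r(I_m;H_m)$. One-sided limits at nodes are written $U(t_m^\pm)$, with the convention $U(t_0^-):=u_0$. $hp$-cG scheme: for $m=1,\dots,M$, $U|_{I_m}\in\mathcal P^{r_m}(I_m;H_m)$ satisfies $\int_{I_m}(U',V)_H\,dt=\int_{I_m}(\mathcal F(t,U),V)_H\,dt$ for all $V\in\mathcal P^{r_m-1}(I_m;H_m)$, and $U(t_{m-1}^+)=\pi_mU(t_{m-1}^-)$. $hp$-dG scheme: for $m=1,\dots,M$, $U|_{I_m}\in\mathcal P^{r_m}(I_m;H_m)$ satisfies $\int_{I_m}(U',V)_H\,dt+(U(t_{m-1}^+)-U(t_{m-1}^-),V(t_{m-1}^+))_H=\int_{I_m}(\mathcal F(t,U),V)_H\,dt$ for all $V\in\mathcal P^{r_m}(I_m;H_m)$. Reconstruction, estimators. For $t\in\bar I_m$: $\widehat U_m(t):=\pi_mU(t_{m-1}^-)+\int_{t_{m-1}}^t\Pi_m^{r_m}\mathcal F(s,U)\,ds$ and $\widehat e_m(t):=u(t)-\widehat U_m(t)$. The residual on $I_m$ is $\mathcal R(t):=\widehat U_m(t_{m-1})-\widehat U_m(t)+\int_{t_{m-1}}^t\mathcal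 F(s,\widehat U_m)\,ds$, and $\eta_m^{\mathrm{res}}:=\|\mathcal R\|_{L^\infty(I_m;H)}$. For $m\ge0$, $\eta_m^{\mathrm{proj}}:=\|U(t_m^-)-\pi_{m+1}U(t_m^-)\|_H$. The numbers $\psi_m$ are any chosen real numbers with $$\psi_1\ge\eta_0^{\mathrm{proj}}+\eta_1^{\mathrm{res}},\qquad \psi_m\ge\|\widehat e_{m-1}(t_{m-1})\|_H+\eta_{m-1}^{\mathrm{proj}}+\eta_m^{\mathrm{res}}\quad(m\ge2).$$ The numbers $\delta_m$. Define $\varphi_m:[1,\infty)\to\mathbb R$ by $$\varphi_m(\delta):=\exp\Big(\int_{I_m}\mathcal L\big(s,\delta\psi_m+\|\widehat U_m(s)\|_H,\|\widehat U_m(s)\|_H\big)\,ds\Big)-\delta,$$ and $\delta_m:=\inf\{\delta>1:\varphi_m(\delta)<0\}\in[1,\infty)$; "$\delta_m$ exists" means that this set is non-empty. *)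

theory Defs
  imports "HOL-Analysis.Analysis" "HOL-Probability.Essential_Supremum"
begin

(*
  All time integrals are written with the Henstock-Kurzweil integral of HOL-Analysis, because the
  library's Bochner integral is only available for second countable target spaces, while the Hilbert
  space here need not be separable.  Every integrand that occurs (for the data and functions
  considered) is strongly measurable with integrable norm, and for such integrands the
  Henstock-Kurzweil integral exists and equals the Bochner (Lebesgue) integral.
*)

definition strongly_measurable :: "'a measure \<Rightarrow> ('a \<Rightarrow> 'b::topological_space) \<Rightarrow> bool" where
  "strongly_measurable M f \<longleftrightarrow>
     (\<exists>s :: nat \<Rightarrow> 'a \<Rightarrow> 'b. (\<forall>n. simple_function M (s n)) \<and> (AE x in M. (\<lambda>n. s n x) \<longlonglongrightarrow> f x))"

(* The norm of L^1(S; H) is not needed, only membership. *)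
definition bochner_L1 :: "real set \<Rightarrow> (real \<Rightarrow> 'a::real_normed_vector) \<Rightarrow> bool" where
  "bochner_L1 S f \<longleftrightarrow>
     strongly_measurable (lebesgue_on S) f \<and> (\<lambda>t. norm (f t)) absolutely_integrable_on S"

definition Linf_norm :: "real set \<Rightarrow> (real \<Rightarrow> 'a::real_normed_vector) \<Rightarrow> ereal" where
  "Linf_norm S f = esssup (lebesgue_on S) (\<lambda>t. ereal (norm (f t)))"

(* Monotone in one argument means nondecreasing.  Continuity is required separately in the second
   and in the third argument; together with monotonicity this is the same as joint continuity. *)
definition local_lipschitz_data ::
  "real \<Rightarrow> (real \<Rightarrow> 'a::{real_inner,complete_space} \<Rightarrow> 'a) \<Rightarrow> (real \<Rightarrow> real \<Rightarrow> real \<Rightarrow> real) \<Rightarrow> bool" where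
  "local_lipschitz_data T F L \<longleftrightarrow>
     (\<forall>v. strongly_measurable (lebesgue_on {0..T}) (\<lambda>t. F t v)) \<and>
     bochner_L1 {0<..<T} (\<lambda>t. F t 0) \<and>
     (\<forall>t\<in>{0..T}. \<forall>v w. norm (F t v - F t w) \<le> L t (norm v) (norm w) * norm (v - w)) \<and>
     (\<forall>t\<in>{0..T}. \<forall>a\<ge>0. \<forall>b\<ge>0. 0 \<le> L t a b) \<and>
     (\<forall>a\<ge>0. \<forall>b\<ge>0. (\<lambda>t. L t a b) absolutely_integrable_on {0<..<T}) \<and>
     (\<forall>t\<in>{0..T}. \<forall>b\<ge>0. continuous_on {0..} (\<lambda>a. L t a b) \<and> mono_on {0..} (\<lambda>a. L t a b)) \<and>
     (\<forall>t\<in>{0..T}. \<forall>a\<ge>0. continuous_on {0..} (\<lambda>b. L t a b) \<and> mono_on {0..} (\<lambda>b. L t a b))"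

definition ivp_solution ::
  "real \<Rightarrow> (real \<Rightarrow> 'a::{real_inner,complete_space} \<Rightarrow> 'a) \<Rightarrow> 'a \<Rightarrow> (real \<Rightarrow> 'a) \<Rightarrow> bool" where
  "ivp_solution T F u0 u \<longleftrightarrow>
     continuous_on {0..T} u \<and> (\<forall>t\<in>{0..T}. u t = u0 + integral {0..t} (\<lambda>s. F s (u s)))"

definition time_partition :: "real \<Rightarrow> nat \<Rightarrow> (nat \<Rightarrow> real) \<Rightarrow> bool" where
  "time_partition T M t \<longleftrightarrow> t 0 = 0 \<and> (\<forall>m<M. t m < t (Suc m)) \<and> t M = T"

definition time_interval :: "(nat \<Rightarrow> real) \<Rightarrow> nat \<Rightarrow> real set" where
  "time_interval t m = {t (m - 1)<..<t m}"

definition finite_dim_subspace :: "'a::real_vector set \<Rightarrow> bool" where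
  "finite_dim_subspace S \<longleftrightarrow> subspace S \<and> (\<exists>B. finite B \<and> span B = S)"

definition orth_proj :: "'a::real_inner set \<Rightarrow> 'a \<Rightarrow> 'a" where
  "orth_proj S x = (THE y. y \<in> S \<and> (\<forall>z\<in>S. inner (x - y) z = 0))"

(* Polynomials are represented by functions on the whole real line, so that each element of
   P^r(I; S) is represented exactly once (I being a nondegenerate interval). *)
definition poly_space :: "nat \<Rightarrow> 'a::real_vector set \<Rightarrow> (real \<Rightarrow> 'a) set" where
  "poly_space r S = {p. \<exists>c. (\<forall>i\<le>r. c i \<in> S) \<and> p = (\<lambda>s. \<Sum>i\<le>r. s ^ i *\<^sub>R c i)}"

definition L2_poly_proj ::
  "nat \<Rightarrow> real set \<Rightarrow> 'a::real_inner set \<Rightarrow> (real \<Rightarrow> 'a) \<Rightarrow> (real \<Rightarrow> 'a)" where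
  "L2_poly_proj r I S f =
     (THE p. p \<in> poly_space r S \<and>
        (\<forall>V\<in>poly_space r S. integral I (\<lambda>s. inner (p s - f s) (V s)) = 0))"

(* U(t_m^-), with the convention U(t_0^-) = u_0. *)
definition left_value :: "'a::t2_space \<Rightarrow> (nat \<Rightarrow> real) \<Rightarrow> (real \<Rightarrow> 'a) \<Rightarrow> nat \<Rightarrow> 'a" where
  "left_value u0 t U m = (if m = 0 then u0 else Lim (at_left (t m)) U)"

(* U(t_m^+) *)
definition right_value :: "(nat \<Rightarrow> real) \<Rightarrow> (real \<Rightarrow> 'a::t2_space) \<Rightarrow> nat \<Rightarrow> 'a" where
  "right_value t U m = Lim (at_right (t m)) U"

(* In both schemes U is only constrained on the open intervals; its values at the nodes are
   irrelevant, and nodal values enter through one-sided limits. *)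
definition cG_solution ::
  "(real \<Rightarrow> 'a::{real_inner,complete_space} \<Rightarrow> 'a) \<Rightarrow> 'a \<Rightarrow> nat \<Rightarrow> (nat \<Rightarrow> real) \<Rightarrow> (nat \<Rightarrow> nat) \<Rightarrow>
     (nat \<Rightarrow> 'a set) \<Rightarrow> (real \<Rightarrow> 'a) \<Rightarrow> bool" where
  "cG_solution F u0 M t r S U \<longleftrightarrow>
     (\<forall>m\<in>{1..M}. 1 \<le> r m \<and>
        (\<exists>p\<in>poly_space (r m) (S m). \<forall>s\<in>time_interval t m. U s = p s) \<and>
        (\<forall>V\<in>poly_space (r m - 1) (S m).
           integral (time_interval t m) (\<lambda>s. inner (vector_derivative U (at s)) (V s)) =
           integral (time_interval t m) (\<lambda>s. inner (F s (U s)) (V s))) \<and>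
        right_value t U (m - 1) = orth_proj (S m) (left_value u0 t U (m - 1)))"

definition dG_solution ::
  "(real \<Rightarrow> 'a::{real_inner,complete_space} \<Rightarrow> 'a) \<Rightarrow> 'a \<Rightarrow> nat \<Rightarrow> (nat \<Rightarrow> real) \<Rightarrow> (nat \<Rightarrow> nat) \<Rightarrow>
     (nat \<Rightarrow> 'a set) \<Rightarrow> (real \<Rightarrow> 'a) \<Rightarrow> bool" where
  "dG_solution F u0 M t r S U \<longleftrightarrow>
     (\<forall>m\<in>{1..M}.
        (\<exists>p\<in>poly_space (r m) (S m). \<forall>s\<in>time_interval t m. U s = p s) \<and>
        (\<forall>V\<in>poly_space (r m) (S m).
           integral (time_interval t m) (\<lambda>s. inner (vector_derivative U (at s)) (V s)) +
           inner (right_value t U (m - 1) - left_value u0 t U (m - 1)) (right_value t V (m - 1)) =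
           integral (time_interval t m) (\<lambda>s. inner (F s (U s)) (V s))))"

definition reconstruction ::
  "(real \<Rightarrow> 'a::{real_inner,complete_space} \<Rightarrow> 'a) \<Rightarrow> 'a \<Rightarrow> (nat \<Rightarrow> real) \<Rightarrow> (nat \<Rightarrow> nat) \<Rightarrow>
     (nat \<Rightarrow> 'a set) \<Rightarrow> (real \<Rightarrow> 'a) \<Rightarrow> nat \<Rightarrow> real \<Rightarrow> 'a" where
  "reconstruction F u0 t r S U m x =
     orth_proj (S m) (left_value u0 t U (m - 1)) +
     integral {t (m - 1)..x} (L2_poly_proj (r m) (time_interval t m) (S m) (\<lambda>s. F s (U s)))"

(* In the following, W stands for the family of reconstructions. *)
definition residual ::
  "(real \<Rightarrow> 'a::{real_inner,complete_space} \<Rightarrow> 'a) \<Rightarrow> (nat \<Rightarrow> real) \<Rightarrow> (nat \<Rightarrow> real \<Rightarrow> 'a) \<Rightarrow>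
     nat \<Rightarrow> real \<Rightarrow> 'a" where
  "residual F t W m x = W m (t (m - 1)) - W m x + integral {t (m - 1)..x} (\<lambda>s. F s (W m s))"

definition eta_res ::
  "(real \<Rightarrow> 'a::{real_inner,complete_space} \<Rightarrow> 'a) \<Rightarrow> (nat \<Rightarrow> real) \<Rightarrow> (nat \<Rightarrow> real \<Rightarrow> 'a) \<Rightarrow>
     nat \<Rightarrow> ereal" where
  "eta_res F t W m = Linf_norm (time_interval t m) (residual F t W m)"

definition eta_proj ::
  "'a::real_inner \<Rightarrow> (nat \<Rightarrow> real) \<Rightarrow> (nat \<Rightarrow> 'a set) \<Rightarrow> (real \<Rightarrow> 'a) \<Rightarrow> nat \<Rightarrow> real" where
  "eta_proj u0 t S U m =
     norm (left_value u0 t U m - orth_proj (S (Suc m)) (left_value u0 t U m))"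

definition phi ::
  "(real \<Rightarrow> real \<Rightarrow> real \<Rightarrow> real) \<Rightarrow> (nat \<Rightarrow> real) \<Rightarrow> (nat \<Rightarrow> real \<Rightarrow> 'a::real_normed_vector) \<Rightarrow>
     (nat \<Rightarrow> real) \<Rightarrow> nat \<Rightarrow> real \<Rightarrow> real" where
  "phi L t W \<psi> m d =
     exp (integral (time_interval t m)
       (\<lambda>s. L s (d * \<psi> m + norm (W m s)) (norm (W m s)))) - d"

definition delta_set ::
  "(real \<Rightarrow> real \<Rightarrow> real \<Rightarrow> real) \<Rightarrow> (nat \<Rightarrow> real) \<Rightarrow> (nat \<Rightarrow> real \<Rightarrow> 'a::real_normed_vector) \<Rightarrow>
     (nat \<Rightarrow> real) \<Rightarrow> nat \<Rightarrow> real set" where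
  "delta_set L t W \<psi> m = {d. 1 < d \<and> phi L t W \<psi> m d < 0}"

definition delta ::
  "(real \<Rightarrow> real \<Rightarrow> real \<Rightarrow> real) \<Rightarrow> (nat \<Rightarrow> real) \<Rightarrow> (nat \<Rightarrow> real \<Rightarrow> 'a::real_normed_vector) \<Rightarrow>
     (nat \<Rightarrow> real) \<Rightarrow> nat \<Rightarrow> real" where
  "delta L t W \<psi> m = Inf (delta_set L t W \<psi> m)"

end

(*
  On I_m the error satisfies
    e(t) = e(t_{m-1}) + R(t) + int_{t_{m-1}}^t (F(s, u) - F(s, Uhat)) ds.
  Testing the scheme with constants shows that Uhat_{m-1}(t_{m-1}) = U(t_{m-1}^-), so the first two
  terms are bounded by psi_m. As long as |e| <= d psi_m, the Lipschitz constant is at most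
  L(s, d psi_m + |Uhat|, |Uhat|), and Gronwall gives |e| <= psi_m exp(int L) < d psi_m for every d
  with phi_m(d) < 0. By continuity |e| <= d psi_m on all of I_m; take the infimum over d.

  H need not be separable, so the Henstock-Kurzweil integrability of s |-> F(s, w(s)) is obtained
  from a completeness argument: a function is integrable if it can be approximated by integrable
  functions up to errors with integrable majorants of arbitrarily small integral.
*)
theory Submission
  imports Defs "HOL-Library.Function_Algebras"
begin

text \<open>The Gronwall kernel contains the norm of u itself, so the estimate is circular until a
  level is fixed. The condition phi_m(d) < 0 says that assuming the level d psi_m returns a strictly
  smaller bound. At delta_m itself this strictness may fail, so levels from \<open>delta_set\<close>
  are used and the infimum comes last. Two features shape the preparations. First, the data are only
  integrable in time, so neither Gronwall nor the measurability of the kernel can rest on continuity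
  in time. Second, \<open>integral\<close> returns a default value on non-integrable functions and
  both projections are defined by \<open>THE\<close>, so integrability, existence and uniqueness
  must be settled before any identity between them can be used.\<close>

section \<open>Integrability in a complete normed space\<close>

text \<open>On a fine division the Riemann sums of \<open>f\<close> and \<open>g\<close> differ by
  at most a Riemann sum of \<open>h\<close>, which is close to its small integral, while the sums of
  \<open>g\<close> are Cauchy. Completeness turns the resulting Cauchy criterion for
  \<open>f\<close> into integrability.\<close>

lemma integrable_on_L1_limit:
  fixes f :: "real \<Rightarrow> 'a::{real_normed_vector,complete_space}"
  assumes "\<And>e. e > 0 \<Longrightarrow> \<exists>g h. g integrable_on {a..b} \<and> (h::real \<Rightarrow> real) integrable_on {a..b} \<and>
     integral {a..b} h < e \<and> (\<forall>x\<in>{a..b}. norm (f x - g x) \<le> h x)"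
  shows "f integrable_on {a..b}"
proof -
  have "\<exists>\<gamma>. gauge \<gamma> \<and>
          (\<forall>\<D>1 \<D>2. \<D>1 tagged_division_of (cbox a b) \<and> \<gamma> fine \<D>1 \<and>
            \<D>2 tagged_division_of (cbox a b) \<and> \<gamma> fine \<D>2 \<longrightarrow>
            norm ((\<Sum>(x,K)\<in>\<D>1. measure lborel K *\<^sub>R f x) - (\<Sum>(x,K)\<in>\<D>2. measure lborel K *\<^sub>R f x)) < e)"
    if "e > 0" for e
  proof -
    obtain g h where g: "g integrable_on cbox a b" and h: "h integrable_on cbox a b"
      and he: "integral (cbox a b) h < e/8" and fg: "\<And>x. x \<in> cbox a b \<Longrightarrow> norm (f x - g x) \<le> h x"
      using assms[of "e/8"] \<open>e > 0\<close> by auto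
    obtain \<gamma>1 where "gauge \<gamma>1" and \<gamma>1: "\<And>\<D>1 \<D>2. \<D>1 tagged_division_of (cbox a b) \<Longrightarrow> \<gamma>1 fine \<D>1 \<Longrightarrow>
            \<D>2 tagged_division_of (cbox a b) \<Longrightarrow> \<gamma>1 fine \<D>2 \<Longrightarrow>
            norm ((\<Sum>(x,K)\<in>\<D>1. measure lborel K *\<^sub>R g x) - (\<Sum>(x,K)\<in>\<D>2. measure lborel K *\<^sub>R g x)) < e/4"
      using g \<open>e > 0\<close> unfolding integrable_Cauchy
      by (metis zero_less_divide_iff zero_less_numeral)
    obtain \<gamma>2 where "gauge \<gamma>2" and \<gamma>2: "\<And>\<D>. \<D> tagged_division_of (cbox a b) \<Longrightarrow> \<gamma>2 fine \<D> \<Longrightarrow>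
            norm ((\<Sum>(x,K)\<in>\<D>. measure lborel K *\<^sub>R h x) - integral (cbox a b) h) < e/8"
      using integrable_integral[OF h] \<open>e > 0\<close> unfolding has_integral
      by (metis zero_less_divide_iff zero_less_numeral)
    \<comment> \<open>One e/8 bounds the integral of \<open>h\<close>, the other the deviation of
      its Riemann sum. Two such comparisons and e/4 for \<open>g\<close> stay below
      \<open>e\<close>.\<close>
    have close: "norm ((\<Sum>(x,K)\<in>\<D>. measure lborel K *\<^sub>R f x) - (\<Sum>(x,K)\<in>\<D>. measure lborel K *\<^sub>R g x)) < e/4"
      if D: "\<D> tagged_division_of (cbox a b)" "\<gamma>2 fine \<D>" for \<D>
    proof -
      have "norm ((\<Sum>(x,K)\<in>\<D>. measure lborel K *\<^sub>R f x) - (\<Sum>(x,K)\<in>\<D>. measure lborel K *\<^sub>R g x))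
            = norm (\<Sum>(x,K)\<in>\<D>. measure lborel K *\<^sub>R (f x - g x))"
        by (simp add: sum_subtractf[symmetric] scaleR_diff_right case_prod_unfold)
      also have "\<dots> \<le> (\<Sum>(x,K)\<in>\<D>. measure lborel K *\<^sub>R h x)"
      proof (rule sum_norm_le)
        fix y assume "y \<in> \<D>"
        then have "fst y \<in> cbox a b"
          using D(1) by (metis prod.collapse subsetD tag_in_interval)
        then show "norm (case y of (x, K) \<Rightarrow> measure lborel K *\<^sub>R (f x - g x)) \<le> (case y of (x, K) \<Rightarrow> measure lborel K *\<^sub>R h x)"
          using fg by (auto simp: case_prod_unfold intro: mult_left_mono)
      qed
      also have "\<dots> < integral (cbox a b) h + e/8"
        using \<gamma>2[OF D] unfolding real_norm_def abs_less_iff by linarith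
      finally show ?thesis using he by simp
    qed
    show ?thesis
    proof (intro exI[of _ "\<lambda>x. \<gamma>1 x \<inter> \<gamma>2 x"] conjI allI impI)
      show "gauge (\<lambda>x. \<gamma>1 x \<inter> \<gamma>2 x)"
        using \<open>gauge \<gamma>1\<close> \<open>gauge \<gamma>2\<close> by (rule gauge_Int)
      fix \<D>1 \<D>2
      assume D: "\<D>1 tagged_division_of cbox a b \<and> (\<lambda>x. \<gamma>1 x \<inter> \<gamma>2 x) fine \<D>1 \<and>
        \<D>2 tagged_division_of cbox a b \<and> (\<lambda>x. \<gamma>1 x \<inter> \<gamma>2 x) fine \<D>2"
      have tri: "norm (p - q) < e" if "norm (p - p') < e/4" "norm (q - q') < e/4" "norm (p' - q') < e/4"
        for p q p' q' :: 'a
        using norm_triangle_le[of "p - p'" "p' - q" "3*e/4"] norm_triangle_le[of "p' - q'" "q' - q" "e/2"]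
          that \<open>e > 0\<close> by (simp add: norm_minus_commute)
      show "norm ((\<Sum>(x,K)\<in>\<D>1. measure lborel K *\<^sub>R f x) - (\<Sum>(x,K)\<in>\<D>2. measure lborel K *\<^sub>R f x)) < e"
        using D by (intro tri[OF close close \<gamma>1]) (auto simp: fine_Int)
    qed
  qed
  then show ?thesis
    unfolding box_real(2)[symmetric] integrable_Cauchy by blast
qed

lemma simple_function_integrable_on:
  fixes s :: "real \<Rightarrow> 'a::real_normed_vector"
  assumes "simple_function (lebesgue_on {a..b}) s"
  shows "s integrable_on {a..b}"
proof -
  have fin: "finite (s ` {a..b})" and
    meas: "\<And>y. y \<in> s ` {a..b} \<Longrightarrow> s -` {y} \<inter> {a..b} \<in> sets (lebesgue_on {a..b})"
    using assms unfolding simple_function_def by auto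
  have "(\<lambda>x. \<Sum>y\<in>s ` {a..b}. indicat_real (s -` {y} \<inter> {a..b}) x *\<^sub>R y) integrable_on {a..b}"
  proof (intro integrable_sum fin integrable_on_scaleR_left)
    fix y assume "y \<in> s ` {a..b}"
    then show "indicat_real (s -` {y} \<inter> {a..b}) integrable_on {a..b}"
      using meas by - (rule measurable_bounded_by_integrable_imp_integrable[where g = "\<lambda>_. 1"],
        auto simp: indicator_def)
  qed
  moreover have "(\<Sum>y\<in>s ` {a..b}. indicat_real (s -` {y} \<inter> {a..b}) x *\<^sub>R y) = s x"
    if "x \<in> {a..b}" for x
  proof -
    have "(\<Sum>y\<in>s ` {a..b}. indicat_real (s -` {y} \<inter> {a..b}) x *\<^sub>R y) = (\<Sum>y\<in>s ` {a..b}. if y = s x then y else 0)"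
      using that by (intro sum.cong) (auto simp: indicator_def)
    then show ?thesis using fin that by (simp add: sum.delta)
  qed
  ultimately show ?thesis
    by (rule integrable_eq)
qed

lemma strongly_measurable_subset:
  assumes "strongly_measurable (lebesgue_on S) f" and A: "A \<subseteq> S" "A \<in> sets lebesgue" and S: "S \<in> sets lebesgue"
  shows "strongly_measurable (lebesgue_on A) f"
proof -
  obtain s where s: "\<And>n. simple_function (lebesgue_on S) (s n)"
    and lim: "AE x in lebesgue_on S. (\<lambda>n. s n x) \<longlonglongrightarrow> f x"
    using assms(1) unfolding strongly_measurable_def by blast
  have "simple_function (lebesgue_on A) (s n)" for n
  proof -
    have "finite (s n ` S)" and "\<And>y. y \<in> s n ` S \<Longrightarrow> s n -` {y} \<inter> S \<in> sets (lebesgue_on S)"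
      using s[of n] unfolding simple_function_def by auto
    moreover have "s n -` {y} \<inter> A = (s n -` {y} \<inter> S) \<inter> A" for y
      using A by auto
    ultimately show ?thesis
      unfolding simple_function_def using A S
      by (auto simp: sets_restrict_space_iff intro: finite_subset[OF image_mono] )
  qed
  moreover have "AE x in lebesgue_on A. (\<lambda>n. s n x) \<longlonglongrightarrow> f x"
    using lim A S by (auto simp: AE_restrict_space_iff elim!: eventually_mono)
  ultimately show ?thesis
    unfolding strongly_measurable_def by blast
qed

text \<open>The simple approximants are cut off at an integrable level. Then dominated convergence
  applies to the real functions \<open>norm (f' x - g n x)\<close>, and
  \<open>integrable_on_L1_limit\<close> finishes.\<close>

lemma strongly_measurable_integrable_on:
  fixes f :: "real \<Rightarrow> 'a::{real_normed_vector,complete_space}"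
  assumes "strongly_measurable (lebesgue_on {a..b}) f"
    and h: "h integrable_on {a..b}" and fh: "\<And>x. x \<in> {a..b} \<Longrightarrow> norm (f x) \<le> h x"
  shows "f integrable_on {a..b}"
proof -
  let ?M = "lebesgue_on {a..b}"
  obtain s where s: "\<And>n. simple_function ?M (s n)"
    and lim: "AE x in ?M. (\<lambda>n. s n x) \<longlonglongrightarrow> f x"
    using assms(1) unfolding strongly_measurable_def by blast
  then obtain N where N: "N \<in> null_sets ?M" and limN: "\<And>x. x \<in> {a..b} - N \<Longrightarrow> (\<lambda>n. s n x) \<longlonglongrightarrow> f x"
    by (auto elim!: AE_E3)
  have hm: "h \<in> borel_measurable ?M"
    using h by (rule integrable_imp_measurable)
  \<comment> \<open>The slack 1 makes the cut-off eventually inactive: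
    \<open>norm (f x) \<le> h x\<close> and convergence force \<open>norm (s n x) < h x + 1\<close>
    for large \<open>n\<close>.\<close>
  define g where "g n x = (if x \<notin> N \<and> norm (s n x) \<le> h x + 1 then s n x else 0)" for n x
  \<comment> \<open>Zero on \<open>N\<close>, so that \<open>g n\<close> converges to
    \<open>f'\<close> at every point of the interval and not just almost everywhere.\<close>
  define f' where "f' x = (if x \<in> N then 0 else f x)" for x
  have gs: "simple_function ?M (g n)" for n
    unfolding g_def
  proof (rule simple_function_If)
    have 1: "(\<lambda>x. norm (s n x)) \<in> borel_measurable ?M"
      using simple_function_compose1[OF s, of norm] by (rule borel_measurable_simple_function)
    have "{x \<in> space ?M. norm (s n x) \<le> h x + 1} - N \<in> sets ?M"
      using N 1 hm by (intro sets.Diff borel_measurable_le borel_measurable_add) auto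
    also have "{x \<in> space ?M. norm (s n x) \<le> h x + 1} - N = {x \<in> space ?M. x \<notin> N \<and> norm (s n x) \<le> h x + 1}"
      by auto
    finally show "{x \<in> space ?M. x \<notin> N \<and> norm (s n x) \<le> h x + 1} \<in> sets ?M" .
  qed (auto simp: s)
  have gf: "(\<lambda>n. g n x) \<longlonglongrightarrow> f' x" if "x \<in> {a..b}" for x
  proof (cases "x \<in> N")
    case False
    have l: "(\<lambda>n. s n x) \<longlonglongrightarrow> f x" using limN False that by simp
    have "eventually (\<lambda>n. norm (s n x) < h x + 1) sequentially"
      using tendsto_norm[OF l] fh[OF that] by (intro order_tendstoD(2)) auto
    then have "eventually (\<lambda>n. s n x = g n x) sequentially"
      by eventually_elim (simp add: g_def False)
    then show ?thesis
      using l False by (simp add: f'_def tendsto_cong)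
  qed (simp add: g_def f'_def)
  have gb: "norm (g n x) \<le> h x + 1" and fb: "norm (f' x) \<le> h x" if "x \<in> {a..b}" for n x
    using order_trans[OF norm_ge_zero fh[OF that]] fh[OF that] unfolding g_def f'_def by auto
  \<comment> \<open>A real limit of norms of differences of simple functions, so that Borel
    measurability of vector-valued differences in a non-separable space never enters.\<close>
  have dm: "(\<lambda>x. norm (f' x - g n x)) \<in> borel_measurable ?M" for n
  proof (rule borel_measurable_LIMSEQ_real)
    show "(\<lambda>x. norm (g k x - g n x)) \<in> borel_measurable ?M" for k
      using simple_function_compose2[OF gs gs, of "\<lambda>x y. norm (x - y)"] by (rule borel_measurable_simple_function)
    show "(\<lambda>k. norm (g k x - g n x)) \<longlonglongrightarrow> norm (f' x - g n x)" if "x \<in> space ?M" for x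
      using that by (intro tendsto_intros gf) auto
  qed
  have h2: "(\<lambda>x. 2 * h x + 1) integrable_on {a..b}"
    by (rule integrable_add[OF integrable_on_mult_right[OF h] integrable_const_ivl])
  have db: "norm (f' x - g n x) \<le> 2 * h x + 1" if "x \<in> {a..b}" for n x
    using norm_triangle_ineq4[of "f' x" "g n x"] gb[OF that, of n] fb[OF that] by linarith
  have dint: "(\<lambda>x. norm (f' x - g n x)) integrable_on {a..b}" for n
    by (rule measurable_bounded_by_integrable_imp_integrable[OF dm h2]) (auto simp: db)
  have "(\<lambda>n. integral {a..b} (\<lambda>x. norm (f' x - g n x))) \<longlonglongrightarrow> integral {a..b} (\<lambda>x. 0::real)"
    using db by (intro dominated_convergence(2)[OF dint h2])
      (auto intro!: tendsto_eq_intros gf)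
  then have dlim: "(\<lambda>n. integral {a..b} (\<lambda>x. norm (f' x - g n x))) \<longlonglongrightarrow> 0"
    by simp
  have "f' integrable_on {a..b}"
  proof (rule integrable_on_L1_limit)
    fix e :: real assume "e > 0"
    then obtain n where "integral {a..b} (\<lambda>x. norm (f' x - g n x)) < e"
      using eventually_happens'[OF sequentially_bot order_tendstoD(2)[OF dlim \<open>e > 0\<close>]] by blast
    then show "\<exists>g h. g integrable_on {a..b} \<and> h integrable_on {a..b} \<and>
       integral {a..b} h < e \<and> (\<forall>x\<in>{a..b}. norm (f' x - g x) \<le> h x)"
      using simple_function_integrable_on[OF gs] dint by blast
  qed
  moreover have "negligible N"
    using N by (simp add: negligible_iff_null_sets null_sets_restrict_space)
  ultimately show ?thesis
    by (rule integrable_spike) (auto simp: f'_def)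
qed

text \<open>\<open>\<alpha>\<close> is rounded down to multiples of 1/(n+1). The rounded function
  takes countably many values, so measurability is glued from the sections of \<open>G\<close>, and
  continuity of \<open>G x\<close> passes to the limit. The rounded values stay in
  \<open>{0..}\<close>, where continuity is assumed.\<close>

lemma caratheodory_measurable:
  fixes G :: "'a \<Rightarrow> real \<Rightarrow> real"
  assumes G: "\<And>y. y \<ge> 0 \<Longrightarrow> (\<lambda>x. G x y) \<in> borel_measurable M"
    and \<alpha>: "\<alpha> \<in> borel_measurable M" "\<And>x. x \<in> space M \<Longrightarrow> 0 \<le> \<alpha> x"
    and cont: "\<And>x. x \<in> space M \<Longrightarrow> continuous_on {0..} (G x)"
  shows "(\<lambda>x. G x (\<alpha> x)) \<in> borel_measurable M"
proof (rule borel_measurable_LIMSEQ_real)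
  define k where "k n x = nat \<lfloor>real (Suc n) * \<alpha> x\<rfloor>" for n x
  define \<alpha>' where "\<alpha>' n x = real (k n x) / real (Suc n)" for n x
  show "(\<lambda>x. G x (\<alpha>' n x)) \<in> borel_measurable M" for n
    unfolding \<alpha>'_def
  proof (rule measurable_compose_countable[where g = "k n"])
    show "(\<lambda>x. G x (real i / real (Suc n))) \<in> borel_measurable M" for i
      by (rule G) simp
    show "k n \<in> M \<rightarrow>\<^sub>M count_space UNIV"
      unfolding k_def using \<alpha>(1) by measurable
  qed
  fix x assume x: "x \<in> space M"
  have "\<bar>\<alpha>' n x - \<alpha> x\<bar> \<le> inverse (real (Suc n))" for n
  proof -
    have "real (k n x) = of_int \<lfloor>real (Suc n) * \<alpha> x\<rfloor>"
      unfolding k_def using \<alpha>(2)[OF x] by simp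
    then have "\<bar>real (k n x) - real (Suc n) * \<alpha> x\<bar> \<le> 1"
      by linarith
    moreover have "\<alpha>' n x - \<alpha> x = (real (k n x) - real (Suc n) * \<alpha> x) * inverse (real (Suc n))"
      unfolding \<alpha>'_def by (simp add: field_simps)
    ultimately show ?thesis
      by (simp add: abs_mult mult_left_le_one_le del: of_nat_Suc)
  qed
  then have "(\<lambda>n. \<alpha>' n x - \<alpha> x) \<longlonglongrightarrow> 0"
    by (intro Lim_null_comparison[OF _ LIMSEQ_inverse_real_of_nat]) auto
  then have "(\<lambda>n. \<alpha>' n x) \<longlonglongrightarrow> \<alpha> x"
    by (rule Lim_null[THEN iffD2])
  then show "(\<lambda>n. G x (\<alpha>' n x)) \<longlonglongrightarrow> G x (\<alpha> x)"
    using \<alpha>(2)[OF x] by (intro continuous_on_tendsto_compose[OF cont[OF x]]) (auto simp: \<alpha>'_def)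
qed

section \<open>Gronwall inequality with an integrable kernel\<close>

lemma integrable_on_mult_continuous:
  fixes l w :: "real \<Rightarrow> real"
  assumes l: "l absolutely_integrable_on {a..b}" and w: "continuous_on {a..b} w"
  shows "(\<lambda>s. l s * w s) integrable_on {a..b}"
proof -
  have "(\<lambda>s. w s * l s) absolutely_integrable_on {a..b}"
    using l w by (intro absolutely_integrable_bounded_measurable_product_real
        continuous_imp_measurable_on_sets_lebesgue compact_imp_bounded compact_continuous_image) auto
  then show ?thesis
    by (simp add: mult.commute set_lebesgue_integral_eq_integral(1))
qed

text \<open>The kernel is only integrable, so differentiating is not available. On a short interval
  \<open>[c, d]\<close> on which \<open>\<theta> = \<integral> l\<close> is small, the right-hand side \<open>v\<close> of the assumption
  satisfies \<open>v d \<le> v c / (1 - \<theta>) \<le> v c * exp ((1 + \<epsilon>) * \<theta>)\<close>, and these bounds multiply up.\<close>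
lemma gronwall_L1:
  fixes w l :: "real \<Rightarrow> real"
  assumes "a \<le> b" and w: "continuous_on {a..b} w" and l: "l integrable_on {a..b}"
    and l0: "\<And>x. x \<in> {a..b} \<Longrightarrow> 0 \<le> l x" and w0: "\<And>x. x \<in> {a..b} \<Longrightarrow> 0 \<le> w x"
    and le: "\<And>x. x \<in> {a..b} \<Longrightarrow> w x \<le> C + integral {a..x} (\<lambda>s. l s * w s)"
  shows "w b \<le> C * exp (integral {a..b} l)"
proof -
  define v where "v x = C + integral {a..x} (\<lambda>s. l s * w s)" for x
  have lw: "(\<lambda>s. l s * w s) integrable_on {a..b}"
    using l l0 w by (intro integrable_on_mult_continuous nonnegative_absolutely_integrable_1)
  have sub: "(\<lambda>s. l s * w s) integrable_on {c..d}" "l integrable_on {c..d}"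
    if "a \<le> c" "d \<le> b" for c d
    using that lw l by (auto intro: integrable_subinterval_real)
  have split: "v d = v c + integral {c..d} (\<lambda>s. l s * w s)"
    "integral {a..d} l = integral {a..c} l + integral {c..d} l"
    if "a \<le> c" "c \<le> d" "d \<le> b" for c d
    unfolding v_def
    using that Henstock_Kurzweil_Integration.integral_combine[of a c d, symmetric] sub[of a d]
    by auto
  have mono: "v c \<le> v d" if "a \<le> c" "c \<le> d" "d \<le> b" for c d
    using that l0 w0 unfolding split(1)[OF that]
    by (auto intro!: integral_nonneg sub)
  have v0: "0 \<le> v x" if "x \<in> {a..b}" for x
    using w0[OF that] le[OF that] unfolding v_def by simp
  have va: "v a = C"
    by (simp add: v_def)
  have step: "v d * (1 - integral {c..d} l) \<le> v c" if cd: "a \<le> c" "c \<le> d" "d \<le> b" for c d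
  proof -
    have "integral {c..d} (\<lambda>s. l s * w s) \<le> integral {c..d} (\<lambda>s. l s * v d)"
    proof (rule integral_le)
      show "(\<lambda>s. l s * v d) integrable_on {c..d}"
        using sub cd by (intro integrable_on_mult_left)
      fix s assume s: "s \<in> {c..d}"
      then have "w s \<le> v d"
        using le[of s] mono[of s d] cd unfolding v_def by auto
      then show "l s * w s \<le> l s * v d"
        using l0[of s] s cd by (auto intro: mult_left_mono)
    qed (use sub cd in auto)
    also have "\<dots> = v d * integral {c..d} l"
      by (simp add: mult.commute)
    finally show ?thesis
      using split(1)[OF cd] by (simp only: right_diff_distrib mult_1_right)
  qed
  have eps: "v b \<le> C * exp ((1 + e) * integral {a..b} l)" if "e > 0" for e
  proof -
    \<comment> \<open>The bisection principle \<open>Bolzano\<close> also tests intervals that leave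
      \<open>{a..b}\<close>; the premise makes \<open>P\<close> trivial there.\<close>
    define P where "P c d \<longleftrightarrow> a \<le> c \<and> c \<le> d \<and> d \<le> b \<longrightarrow> v d \<le> v c * exp ((1 + e) * integral {c..d} l)" for c d
    have "P a b"
      using \<open>a \<le> b\<close>
    proof (induction rule: Bolzano)
      case (trans c d f)
      show ?case
        unfolding P_def
      proof
        assume ab: "a \<le> c \<and> c \<le> f \<and> f \<le> b"
        have "v f \<le> v d * exp ((1 + e) * integral {d..f} l)"
          using trans ab unfolding P_def by auto
        also have "\<dots> \<le> v c * exp ((1 + e) * integral {c..d} l) * exp ((1 + e) * integral {d..f} l)"
          using trans ab unfolding P_def by auto
        also have "\<dots> = v c * exp ((1 + e) * integral {c..f} l)"
          using Henstock_Kurzweil_Integration.integral_combine[of c d f l] trans ab sub[of c f]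
          by (simp add: exp_add[symmetric] distrib_left[symmetric])
        finally show "v f \<le> v c * exp ((1 + e) * integral {c..f} l)" .
      qed
    next
      case (local x)
      let ?\<Lambda> = "\<lambda>x. integral {a..x} l"
      \<comment> \<open>\<open>q\<close> is the threshold with (1 + e)(1 - q) = 1. \<open>h\<close>
        is half of it because the integral over \<open>{c..d}\<close> is estimated through
        \<open>x\<close> from both endpoints.\<close>
      define q where "q = e / (1 + e)"
      define h where "h = q / 2"
      have "h > 0" using \<open>e > 0\<close> by (simp add: h_def q_def)
      have "continuous_on {a..b} ?\<Lambda>"
        using l by (rule indefinite_integral_continuous_1)
      then obtain r where "r > 0" and r: "\<And>y. y \<in> {a..b} \<Longrightarrow> dist y x < r \<Longrightarrow> dist (?\<Lambda> y) (?\<Lambda> x) < h"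
        using local \<open>h > 0\<close> unfolding continuous_on_iff by (metis atLeastAtMost_iff)
      have "P c d" if "c \<le> x \<and> x \<le> d \<and> d - c < r" for c d
        unfolding P_def
      proof
        assume cd: "a \<le> c \<and> c \<le> d \<and> d \<le> b"
        define \<theta> where "\<theta> = integral {c..d} l"
        have "\<theta> = ?\<Lambda> d - ?\<Lambda> c"
          using split(2)[of c d] cd by (simp add: \<theta>_def)
        moreover have "dist (?\<Lambda> d) (?\<Lambda> x) < h" "dist (?\<Lambda> c) (?\<Lambda> x) < h"
          using that cd r[of c] r[of d] by (auto simp: dist_real_def)
        ultimately have "\<theta> < 2 * h"
          unfolding dist_real_def by linarith
        then have th: "\<theta> < q"
          unfolding h_def by linarith
        then have small: "(1 + e) * (1 - \<theta>) \<ge> 1"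
          using \<open>e > 0\<close> by (simp add: q_def field_simps)
        have "q < 1"
          using \<open>e > 0\<close> by (simp add: q_def)
        with th have "\<theta> < 1"
          by simp
        have "\<theta> \<ge> 0"
          using cd l0 unfolding \<theta>_def by (auto intro!: integral_nonneg sub)
        \<comment> \<open>This is 1 / (1 - \<theta>) \<le> 1 + (1 + e) \<theta>, cleared of the
          denominator.\<close>
        have "1 \<le> (1 + (1 + e) * \<theta>) * (1 - \<theta>)"
        proof -
          have "(1 + (1 + e) * \<theta>) * (1 - \<theta>) = 1 - \<theta> + \<theta> * ((1 + e) * (1 - \<theta>))"
            by (simp add: algebra_simps)
          moreover have "\<theta> * ((1 + e) * (1 - \<theta>)) \<ge> \<theta> * 1"
            using small \<open>\<theta> \<ge> 0\<close> by (intro mult_left_mono)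
          ultimately show ?thesis by simp
        qed
        also have "\<dots> \<le> exp ((1 + e) * \<theta>) * (1 - \<theta>)"
          using \<open>\<theta> < 1\<close> by (intro mult_right_mono exp_ge_add_one_self) auto
        finally have "1 * v d \<le> exp ((1 + e) * \<theta>) * (1 - \<theta>) * v d"
          using v0[of d] cd by (intro mult_right_mono) auto
        also have "\<dots> \<le> exp ((1 + e) * \<theta>) * v c"
          using step[of c d] cd by (simp add: \<theta>_def mult.commute mult.left_commute)
        finally show "v d \<le> v c * exp ((1 + e) * integral {c..d} l)"
          by (simp add: \<theta>_def mult.commute)
      qed
      then show ?case
        using \<open>r > 0\<close> by blast
    qed
    then show ?thesis
      using \<open>a \<le> b\<close> by (simp add: P_def va)
  qed
  \<comment> \<open>The surplus \<open>e\<close> in the exponent was only slack; it now decreases to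
    0.\<close>
  have "v b \<le> C * exp ((1 + 0) * integral {a..b} l)"
  proof (rule tendsto_lowerbound)
    show "((\<lambda>e. C * exp ((1 + e) * integral {a..b} l)) \<longlongrightarrow> C * exp ((1 + 0) * integral {a..b} l)) (at_right 0)"
      by (intro tendsto_intros)
    show "\<forall>\<^sub>F e in at_right 0. v b \<le> C * exp ((1 + e) * integral {a..b} l)"
      using eps by (simp add: eventually_at_right_less eventually_mono[OF eventually_at_right_less])
  qed simp
  then show ?thesis
    using le[of b] \<open>a \<le> b\<close> by (simp add: v_def)
qed

section \<open>Vector-valued integrals tested against vectors\<close>

text \<open>Take \<open>v = z\<close>. This reduces norm estimates of vector-valued integrals to
  real integrals of inner products.\<close>

lemma norm_le_if_inner_le:
  fixes z :: "'a::real_inner"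
  assumes "\<And>v. inner z v \<le> B * norm v" and "0 \<le> B"
  shows "norm z \<le> B"
proof (cases "z = 0")
  case False
  have "norm z * norm z \<le> B * norm z"
    using assms(1)[of z] by (simp add: dot_square_norm power2_eq_square)
  then show ?thesis using False by simp
qed (use assms in simp)

lemma has_integral_inner_left_vec:
  fixes f :: "real \<Rightarrow> 'a::real_inner"
  assumes "(f has_integral y) S"
  shows "((\<lambda>s. inner (f s) v) has_integral inner y v) S"
  using has_integral_linear[OF assms bounded_linear_inner_left[of v]] by (simp add: o_def)

text \<open>The library versions of the next two lemmas need the sort \<open>banach\<close>, which
  \<open>{real_inner, complete_space}\<close> does not entail.\<close>
lemma norm_integral_le_inner:
  fixes f :: "real \<Rightarrow> 'a::real_inner"
  assumes f: "f integrable_on {a..b}" and h: "h integrable_on {a..b}"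
    and le: "\<And>x. x \<in> {a..b} \<Longrightarrow> norm (f x) \<le> h x"
  shows "norm (integral {a..b} f) \<le> integral {a..b} h"
proof (rule norm_le_if_inner_le)
  fix v
  show "inner (integral {a..b} f) v \<le> integral {a..b} h * norm v"
  proof (rule has_integral_le)
    show "((\<lambda>s. inner (f s) v) has_integral inner (integral {a..b} f) v) {a..b}"
      using f by (intro has_integral_inner_left_vec integrable_integral)
    show "((\<lambda>s. h s * norm v) has_integral integral {a..b} h * norm v) {a..b}"
      using h by (intro has_integral_mult_left integrable_integral)
    fix x assume "x \<in> {a..b}"
    then show "inner (f x) v \<le> h x * norm v"
      using norm_cauchy_schwarz[of "f x" v] mult_right_mono[OF le norm_ge_zero] by (rule_tac order_trans)
  qed
next
  show "0 \<le> integral {a..b} h"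
    using le by (intro integral_nonneg[OF h]) (meson norm_ge_zero order_trans)
qed

lemma integral_combine_inner:
  fixes f :: "real \<Rightarrow> 'a::real_inner"
  assumes "a \<le> c" "c \<le> b"
    and f: "f integrable_on {a..b}" "f integrable_on {a..c}" "f integrable_on {c..b}"
  shows "integral {a..b} f = integral {a..c} f + integral {c..b} f"
proof -
  have "inner (integral {a..b} f) v = inner (integral {a..c} f + integral {c..b} f) v" for v
  proof -
    have i: "((\<lambda>s. inner (f s) v) has_integral inner (integral S f) v) S" if "f integrable_on S" for S
      using that by (intro has_integral_inner_left_vec integrable_integral)
    show ?thesis
      using has_integral_combine[OF assms(1,2) i[OF f(2)] i[OF f(3)]] i[OF f(1)]
      by (simp add: inner_add_left has_integral_unique)
  qed
  then show ?thesis
    by (metis vector_eq_rdot)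
qed

section \<open>Superposition with the data of the initial value problem\<close>

lemma continuous_on_Icc_norm_boundE:
  fixes w :: "real \<Rightarrow> 'a::real_normed_vector"
  assumes "continuous_on {p..q} w"
  obtains K where "\<And>s. s \<in> {p..q} \<Longrightarrow> norm (w s) \<le> K"
  using compact_imp_bounded[OF compact_continuous_image[OF assms compact_Icc]]
  unfolding bounded_iff by blast

context
  fixes T :: real
    and F :: "real \<Rightarrow> 'a::{real_inner,complete_space} \<Rightarrow> 'a"
    and L :: "real \<Rightarrow> real \<Rightarrow> real \<Rightarrow> real"
  assumes data: "local_lipschitz_data T F L"
begin

lemma lipschitz_bound: "t \<in> {0..T} \<Longrightarrow> norm (F t v - F t w) \<le> L t (norm v) (norm w) * norm (v - w)"
  by (rule data[unfolded local_lipschitz_data_def, THEN conjunct2, THEN conjunct2, THEN conjunct1, rule_format])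

lemma lipschitz_constant_nonneg: "t \<in> {0..T} \<Longrightarrow> 0 \<le> a \<Longrightarrow> 0 \<le> b \<Longrightarrow> 0 \<le> L t a b"
  by (rule data[unfolded local_lipschitz_data_def, THEN conjunct2, THEN conjunct2, THEN conjunct2, THEN conjunct1, rule_format])

lemma lipschitz_constant_regular:
  assumes "t \<in> {0..T}" "0 \<le> b"
  shows "continuous_on {0..} (\<lambda>a. L t a b)" "mono_on {0..} (\<lambda>a. L t a b)"
    and "continuous_on {0..} (L t b)" "mono_on {0..} (L t b)"
  using assms data[unfolded local_lipschitz_data_def, THEN conjunct2, THEN conjunct2,
      THEN conjunct2, THEN conjunct2, THEN conjunct2]
  by (simp_all only:)

lemma lipschitz_constant_mono:
  assumes t: "t \<in> {0..T}" and ab: "0 \<le> a" "a \<le> a'" "0 \<le> b" "b \<le> b'"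
  shows "L t a b \<le> L t a' b'"
proof -
  have "mono_on {0..} (\<lambda>a. L t a b)" "mono_on {0..} (L t a')"
    using t ab by (auto intro: lipschitz_constant_regular)
  then have "L t a b \<le> L t a' b" "L t a' b \<le> L t a' b'"
    using ab by (auto simp: mono_on_def)
  then show ?thesis by simp
qed

lemma lipschitz_constant_integrable:
  assumes "0 \<le> p" "q \<le> T" and "0 \<le> a" "0 \<le> b"
  shows "(\<lambda>t. L t a b) integrable_on {p..q}"
proof -
  have "(\<lambda>t. L t a b) absolutely_integrable_on {0<..<T}"
    using assms by (intro data[unfolded local_lipschitz_data_def, THEN conjunct2, THEN conjunct2,
        THEN conjunct2, THEN conjunct2, THEN conjunct1, rule_format])
  then have "(\<lambda>t. L t a b) integrable_on {0..T}"
    by (simp add: set_lebesgue_integral_eq_integral(1) flip: integrable_on_open_interval_real)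
  then show ?thesis
    using assms by (auto intro: integrable_subinterval_real)
qed

text \<open>Inserting \<open>\<alpha>\<close> with the third argument frozen, and then
  \<open>\<beta>\<close>, gives measurability by two applications of
  \<open>caratheodory_measurable\<close>. With upper bounds \<open>A\<close> and \<open>B\<close> of
  the two functions, monotonicity supplies the integrable majorant \<open>L s A B\<close>.\<close>

lemma lipschitz_constant_integrable_comp:
  assumes "0 \<le> p" "q \<le> T"
    and \<alpha>: "continuous_on {p..q} \<alpha>" "\<And>s. s \<in> {p..q} \<Longrightarrow> 0 \<le> \<alpha> s"
    and \<beta>: "continuous_on {p..q} \<beta>" "\<And>s. s \<in> {p..q} \<Longrightarrow> 0 \<le> \<beta> s"
  shows "(\<lambda>s. L s (\<alpha> s) (\<beta> s)) integrable_on {p..q}"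
proof -
  obtain A where A: "\<And>s. s \<in> {p..q} \<Longrightarrow> norm (\<alpha> s) \<le> A"
    using continuous_on_Icc_norm_boundE[OF \<alpha>(1)] by blast
  obtain B where B: "\<And>s. s \<in> {p..q} \<Longrightarrow> norm (\<beta> s) \<le> B"
    using continuous_on_Icc_norm_boundE[OF \<beta>(1)] by blast
  have sub: "s \<in> {0..T}" if "s \<in> {p..q}" for s
    using that assms(1,2) by auto
  have c1: "continuous_on {0..} (\<lambda>a. L s a b)" if "s \<in> {p..q}" "0 \<le> b" for s b
    using sub[OF that(1)] that by (intro lipschitz_constant_regular)
  have c2: "continuous_on {0..} (L s a)" if "s \<in> {p..q}" "0 \<le> a" for s a
    using sub[OF that(1)] that by (intro lipschitz_constant_regular)
  have m\<alpha>: "\<alpha> \<in> borel_measurable (lebesgue_on {p..q})" and m\<beta>: "\<beta> \<in> borel_measurable (lebesgue_on {p..q})"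
    using \<alpha>(1) \<beta>(1) by (auto intro: continuous_imp_measurable_on_sets_lebesgue)
  have 1: "(\<lambda>s. L s a b) \<in> borel_measurable (lebesgue_on {p..q})" if "0 \<le> a" "0 \<le> b" for a b
    using lipschitz_constant_integrable[OF assms(1,2) that] by (rule integrable_imp_measurable)
  have 2: "(\<lambda>s. L s (\<alpha> s) b) \<in> borel_measurable (lebesgue_on {p..q})" if "0 \<le> b" for b
    by (rule caratheodory_measurable[where G = "\<lambda>s a. L s a b"]) (use 1 that m\<alpha> \<alpha>(2) c1 in auto)
  have 3: "(\<lambda>s. L s (\<alpha> s) (\<beta> s)) \<in> borel_measurable (lebesgue_on {p..q})"
    by (rule caratheodory_measurable[where G = "\<lambda>s. L s (\<alpha> s)"]) (use 2 m\<beta> \<beta>(2) \<alpha>(2) c2 in auto)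
  show ?thesis
  proof (cases "p \<le> q")
    case True
    then have "0 \<le> A" "0 \<le> B"
      using A[of p] B[of p] by (auto intro: order_trans[OF abs_ge_zero])
    then have "(\<lambda>s. L s A B) integrable_on {p..q}"
      using assms(1,2) by (intro lipschitz_constant_integrable)
    then show ?thesis
    proof (rule measurable_bounded_by_integrable_imp_integrable[OF 3])
      fix s assume s: "s \<in> {p..q}"
      then show "norm (L s (\<alpha> s) (\<beta> s)) \<le> L s A B"
        using lipschitz_constant_nonneg[OF sub[OF s] \<alpha>(2)[OF s] \<beta>(2)[OF s]] A[OF s] B[OF s] \<alpha>(2)[OF s] \<beta>(2)[OF s]
        by (auto intro!: lipschitz_constant_mono sub)
    qed auto
  qed auto
qed

text \<open>Comparison with \<open>F t 0\<close>. The right-hand side depends on \<open>v\<close>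
  only through \<open>K\<close>, so it serves as an integrable majorant when a bounded function of
  time is inserted for \<open>v\<close>.\<close>

lemma norm_F_le:
  assumes "t \<in> {0..T}" "norm v \<le> K"
  shows "norm (F t v) \<le> norm (F t 0) + L t K 0 * K"
proof -
  have "norm (F t v) \<le> norm (F t 0) + norm (F t v - F t 0)"
    by (metis add.commute diff_add_cancel norm_triangle_ineq)
  also have "norm (F t v - F t 0) \<le> L t (norm v) 0 * norm v"
    using lipschitz_bound[OF assms(1), of v 0] by simp
  also have "\<dots> \<le> L t K 0 * K"
    using assms order_trans[OF norm_ge_zero assms(2)]
    by (intro mult_mono lipschitz_constant_mono lipschitz_constant_nonneg) auto
  finally show ?thesis by simp
qed

lemma norm_F_bound_integrable:
  assumes "0 \<le> p" "q \<le> T" "0 \<le> K"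
  shows "(\<lambda>t. norm (F t 0) + L t K 0 * K) integrable_on {p..q}"
proof -
  have "(\<lambda>t. norm (F t 0)) absolutely_integrable_on {0<..<T}"
    using data unfolding local_lipschitz_data_def bochner_L1_def by (elim conjE)
  then have "(\<lambda>t. norm (F t 0)) integrable_on {0..T}"
    by (simp add: set_lebesgue_integral_eq_integral(1) flip: integrable_on_open_interval_real)
  then have "(\<lambda>t. norm (F t 0)) integrable_on {p..q}"
    using assms by (auto intro: integrable_subinterval_real)
  then show ?thesis
    using assms by (intro integrable_add integrable_on_mult_left lipschitz_constant_integrable) auto
qed

text \<open>The pieces from which approximants of \<open>F t (w t)\<close> are assembled: second
  argument frozen, support cut down to \<open>A\<close>, later a subinterval. Setting the
  approximating simple functions to 0 outside \<open>A\<close> keeps them simple.\<close>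

lemma F_indicator_integrable:
  assumes "0 \<le> p" "q \<le> T" "A \<in> sets lebesgue"
  shows "(\<lambda>t. indicat_real A t *\<^sub>R F t v) integrable_on {p..q}"
proof -
  let ?M = "lebesgue_on {p..q}"
  have "strongly_measurable (lebesgue_on {0..T}) (\<lambda>t. F t v)"
    using data unfolding local_lipschitz_data_def by (elim conjE) (erule spec)
  then have "strongly_measurable ?M (\<lambda>t. F t v)"
    using assms by (auto intro: strongly_measurable_subset)
  then obtain s where s: "\<And>n. simple_function ?M (s n)" "AE t in ?M. (\<lambda>n. s n t) \<longlonglongrightarrow> F t v"
    unfolding strongly_measurable_def by blast
  have "strongly_measurable ?M (\<lambda>t. indicat_real A t *\<^sub>R F t v)"
    unfolding strongly_measurable_def
  proof (intro exI conjI allI)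
    show "simple_function ?M (\<lambda>t. if t \<in> A then s n t else 0)" for n
    proof (rule simple_function_If[OF s(1)])
      have "{x \<in> space ?M. x \<in> A} = A \<inter> {p..q}" by auto
      then show "{x \<in> space ?M. x \<in> A} \<in> sets ?M"
        using assms(3) by (auto simp: sets_restrict_space)
    qed simp
    show "AE t in ?M. (\<lambda>n. if t \<in> A then s n t else 0) \<longlonglongrightarrow> indicat_real A t *\<^sub>R F t v"
      using s(2) by eventually_elim (simp add: indicator_def)
  qed
  then show ?thesis
  proof (rule strongly_measurable_integrable_on)
    show "(\<lambda>t. norm (F t 0) + L t (norm v) 0 * norm v) integrable_on {p..q}"
      using assms by (intro norm_F_bound_integrable) auto
    show "norm (indicat_real A t *\<^sub>R F t v) \<le> norm (F t 0) + L t (norm v) 0 * norm v" if "t \<in> {p..q}" for t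
      using norm_F_le[of t v "norm v"] that assms order_trans[OF norm_ge_zero, of "F t v"]
      by (auto simp: indicator_def)
  qed
qed

lemma F_comp_integrable:
  assumes pq: "0 \<le> p" "q \<le> T" and w: "continuous_on {p..q} w"
  shows "(\<lambda>t. F t (w t)) integrable_on {p..q}"
proof (cases "p \<le> q")
  case True
  obtain K where K: "\<And>s. s \<in> {p..q} \<Longrightarrow> norm (w s) \<le> K"
    using continuous_on_Icc_norm_boundE[OF w] by blast
  have "0 \<le> K"
    using K[of p] True by (auto intro: order_trans[OF norm_ge_zero])
  have sub: "s \<in> {0..T}" if "s \<in> {p..q}" for s
    using that pq by auto
  have Lint: "(\<lambda>s. L s K K) integrable_on {p..q}"
    using pq \<open>0 \<le> K\<close> by (intro lipschitz_constant_integrable)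
  have L0: "0 \<le> L s K K" if "s \<in> {p..q}" for s
    using sub[OF that] \<open>0 \<le> K\<close> by (intro lipschitz_constant_nonneg)
  define I where "I = integral {p..q} (\<lambda>s. L s K K)"
  have "0 \<le> I"
    unfolding I_def using L0 by (intro integral_nonneg[OF Lint])
  \<comment> \<open>The pieces live on half-open intervals, so that neighbours do not overlap.
    Together they miss the point \<open>q\<close>, where \<open>f\<close> is therefore set to
    0.\<close>
  define f where "f t = (if t = q then 0 else F t (w t))" for t
  have "f integrable_on {p..q}"
  proof (rule integrable_on_L1_limit)
    fix e :: real assume "e > 0"
    \<comment> \<open>The summand 1 keeps the denominator positive for \<open>I = 0\<close> and
      yields \<open>I * d < e\<close>.\<close>
    define d where "d = e / (I + 1)"
    have "d > 0" using \<open>e > 0\<close> \<open>0 \<le> I\<close> by (simp add: d_def)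
    \<comment> \<open>\<open>g\<close> vanishes off its piece, so approximants on adjacent pieces
      can simply be added.\<close>
    define P where "P c c' \<longleftrightarrow> (\<exists>g. g integrable_on {p..q} \<and>
      (\<forall>s\<in>{p..q}. (s \<in> {c..<c'} \<longrightarrow> norm (F s (w s) - g s) \<le> L s K K * d) \<and> (s \<notin> {c..<c'} \<longrightarrow> g s = 0)))" for c c'
    have "P p q"
      using True
    proof (induction rule: Bolzano)
      case (trans x y z)
      obtain g where g: "g integrable_on {p..q}" "\<And>s. s \<in> {p..q} \<Longrightarrow> s \<in> {x..<y} \<Longrightarrow> norm (F s (w s) - g s) \<le> L s K K * d"
        "\<And>s. s \<in> {p..q} \<Longrightarrow> s \<notin> {x..<y} \<Longrightarrow> g s = 0"
        using trans(1) unfolding P_def by blast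
      obtain g' where g': "g' integrable_on {p..q}" "\<And>s. s \<in> {p..q} \<Longrightarrow> s \<in> {y..<z} \<Longrightarrow> norm (F s (w s) - g' s) \<le> L s K K * d"
        "\<And>s. s \<in> {p..q} \<Longrightarrow> s \<notin> {y..<z} \<Longrightarrow> g' s = 0"
        using trans(2) unfolding P_def by blast
      have "norm (F s (w s) - (g s + g' s)) \<le> L s K K * d" if "s \<in> {p..q}" "s \<in> {x..<z}" for s
        using g(2,3)[of s] g'(2,3)[of s] that by (cases "s < y") auto
      then show ?case
        unfolding P_def using g g' trans(3,4)
        by (intro exI[of _ "\<lambda>s. g s + g' s"]) (auto intro: integrable_add)
    next
      case (local x)
      then obtain r where "r > 0" and r: "\<And>y. y \<in> {p..q} \<Longrightarrow> dist y x < r \<Longrightarrow> dist (w y) (w x) < d"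
        using w \<open>d > 0\<close> unfolding continuous_on_iff by (metis atLeastAtMost_iff)
      have "P c c'" if cc: "c \<le> x \<and> x \<le> c' \<and> c' - c < r" for c c'
        unfolding P_def
      proof (intro exI conjI ballI impI)
        show "(\<lambda>t. indicat_real {c..<c'} t *\<^sub>R F t (w x)) integrable_on {p..q}"
          using pq by (intro F_indicator_integrable) auto
        show "indicat_real {c..<c'} s *\<^sub>R F s (w x) = 0" if "s \<notin> {c..<c'}" for s
          using that by simp
        fix s assume s: "s \<in> {p..q}" "s \<in> {c..<c'}"
        have "norm (F s (w s) - F s (w x)) \<le> L s (norm (w s)) (norm (w x)) * norm (w s - w x)"
          by (rule lipschitz_bound[OF sub[OF s(1)]])
        also have "\<dots> \<le> L s K K * d"
        proof (intro mult_mono lipschitz_constant_mono)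
          have "dist s x < r"
            using s(2) cc by (auto simp: dist_real_def abs_if)
          then show "norm (w s - w x) \<le> d"
            using r[OF s(1)] by (simp add: dist_norm)
        qed (use s K[of s] K[of x] local L0[OF s(1)] sub[OF s(1)] in auto)
        finally show "norm (F s (w s) - indicat_real {c..<c'} s *\<^sub>R F s (w x)) \<le> L s K K * d"
          using s by simp
      qed
      then show ?case
        using \<open>r > 0\<close> by blast
    qed
    then obtain g where g: "g integrable_on {p..q}" "\<And>s. s \<in> {p..q} \<Longrightarrow> s \<in> {p..<q} \<Longrightarrow> norm (F s (w s) - g s) \<le> L s K K * d"
      "\<And>s. s \<in> {p..q} \<Longrightarrow> s \<notin> {p..<q} \<Longrightarrow> g s = 0"
      unfolding P_def by blast
    show "\<exists>g h. g integrable_on {p..q} \<and> h integrable_on {p..q} \<and>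
       integral {p..q} h < e \<and> (\<forall>x\<in>{p..q}. norm (f x - g x) \<le> h x)"
    proof (intro exI conjI ballI)
      show "g integrable_on {p..q}" by fact
      show "(\<lambda>s. L s K K * d) integrable_on {p..q}"
        using Lint by (rule integrable_on_mult_left)
      have "I * d < e"
        using \<open>e > 0\<close> \<open>0 \<le> I\<close> by (simp add: d_def field_simps)
      then show "integral {p..q} (\<lambda>s. L s K K * d) < e"
        by (simp add: I_def)
      fix s assume s: "s \<in> {p..q}"
      show "norm (f s - g s) \<le> L s K K * d"
        using g(2,3)[OF s] s L0[OF s] \<open>d > 0\<close> by (cases "s = q") (auto simp: f_def)
    qed
  qed
  then show ?thesis
    by (rule integrable_spike[where S = "{q}"]) (auto simp: f_def)
qed auto

lemma F_comp_integral_combine: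
  assumes "0 \<le> p" "p \<le> x" "x \<le> q" "q \<le> T" and w: "continuous_on {p..q} w"
  shows "integral {p..q} (\<lambda>t. F t (w t)) = integral {p..x} (\<lambda>t. F t (w t)) + integral {x..q} (\<lambda>t. F t (w t))"
  using assms by (intro integral_combine_inner F_comp_integrable)
    (auto intro: continuous_on_subset)

text \<open>Increments of the vector integral are dominated by increments of the real primitive
  \<open>H\<close> of an integrable majorant, and continuity is inherited from
  \<open>H\<close>.\<close>

lemma F_comp_integral_continuous:
  assumes pq: "0 \<le> p" "q \<le> T" and w: "continuous_on {p..q} w"
  shows "continuous_on {p..q} (\<lambda>x. integral {p..x} (\<lambda>t. F t (w t)))"
proof -
  obtain K where K: "\<And>s. s \<in> {p..q} \<Longrightarrow> norm (w s) \<le> K"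
    using continuous_on_Icc_norm_boundE[OF w] by blast
  \<comment> \<open>The absolute value covers an empty interval, for which the bound
    \<open>K\<close> may be negative.\<close>
  define h where "h t = norm (F t 0) + L t \<bar>K\<bar> 0 * \<bar>K\<bar>" for t
  define H where "H x = integral {p..x} h" for x
  have h: "h integrable_on {c..d}" if "p \<le> c" "d \<le> q" for c d
    unfolding h_def using pq that by (intro norm_F_bound_integrable) auto
  have H: "continuous_on {p..q} H"
    unfolding H_def by (intro indefinite_integral_continuous_1 h) auto
  have le: "dist (integral {p..y} (\<lambda>t. F t (w t))) (integral {p..x} (\<lambda>t. F t (w t))) \<le> dist (H y) (H x)"
    if "x \<in> {p..q}" "y \<in> {p..q}" "x \<le> y" for x y
  proof -
    have "integral {p..y} (\<lambda>t. F t (w t)) - integral {p..x} (\<lambda>t. F t (w t)) = integral {x..y} (\<lambda>t. F t (w t))"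
      using F_comp_integral_combine[of p x y w] that pq continuous_on_subset[OF w, of "{p..y}"] by auto
    moreover have "norm (integral {x..y} (\<lambda>t. F t (w t))) \<le> integral {x..y} h"
    proof (rule norm_integral_le_inner)
      show "(\<lambda>t. F t (w t)) integrable_on {x..y}"
        using that pq by (intro F_comp_integrable continuous_on_subset[OF w]) auto
      show "h integrable_on {x..y}" using that by (intro h) auto
      fix s assume "s \<in> {x..y}"
      then show "norm (F s (w s)) \<le> h s"
        using K[of s] that pq unfolding h_def by (intro norm_F_le) auto
    qed
    moreover have "integral {x..y} h = H y - H x"
      unfolding H_def using Henstock_Kurzweil_Integration.integral_combine[of p x y h] h[of p y] that by auto
    ultimately show ?thesis
      by (simp add: dist_norm)
  qed
  have "dist (integral {p..y} (\<lambda>t. F t (w t))) (integral {p..x} (\<lambda>t. F t (w t))) \<le> dist (H y) (H x)"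
    if "x \<in> {p..q}" "y \<in> {p..q}" for x y
    using le[of x y] le[of y x] that by (cases "x \<le> y") (auto simp: dist_commute)
  then show ?thesis
    using H unfolding continuous_on_iff by (meson le_less_trans)
qed

end

section \<open>Projections onto finite-dimensional spaces\<close>

text \<open>Gram-Schmidt by induction on the generators. The scaling is a parameter so that the
  result serves both H (orthogonal projection) and functions of time (L2 projection).\<close>

lemma riesz_on_span:
  fixes scale :: "real \<Rightarrow> 'v::ab_group_add \<Rightarrow> 'v" and B :: "'v \<Rightarrow> 'v \<Rightarrow> real"
  assumes vs: "vector_space scale" and X: "module.subspace scale X"
    and "finite G" "G \<subseteq> X"
    and B_add: "\<And>x y z. x \<in> X \<Longrightarrow> y \<in> X \<Longrightarrow> z \<in> X \<Longrightarrow> B (x + y) z = B x z + B y z"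
    and B_scale: "\<And>c x z. x \<in> X \<Longrightarrow> z \<in> X \<Longrightarrow> B (scale c x) z = c * B x z"
    and B_sym: "\<And>x y. x \<in> X \<Longrightarrow> y \<in> X \<Longrightarrow> B x y = B y x"
    and B_pos: "\<And>x. x \<in> X \<Longrightarrow> B x x = 0 \<Longrightarrow> x = 0"
    and f_add: "\<And>x y. x \<in> X \<Longrightarrow> y \<in> X \<Longrightarrow> f (x + y) = f x + f y"
    and f_scale: "\<And>c x. x \<in> X \<Longrightarrow> f (scale c x) = c * f x"
  shows "\<exists>p\<in>module.span scale G. \<forall>v\<in>module.span scale G. B p v = f v"
proof -
  interpret V: vector_space scale by (rule vs)
  show ?thesis
    using \<open>finite G\<close> \<open>G \<subseteq> X\<close> f_add f_scale
  proof (induction G arbitrary: f rule: finite_induct)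
    case empty
    have "f 0 = 0"
      using empty.prems(3)[of 0 0] V.subspace_0[OF X] by simp
    moreover have "B 0 0 = 0"
      using B_scale[of 0 0 0] V.subspace_0[OF X] by simp
    ultimately show ?case
      by simp
  next
    case (insert g G)
    have gX: "g \<in> X" and GX: "V.span G \<subseteq> X"
      using insert.prems(1) V.span_minimal[OF _ X] by auto
    obtain p where p: "p \<in> V.span G" "\<And>v. v \<in> V.span G \<Longrightarrow> B p v = f v"
      using insert.IH[of f] insert.prems by blast
    \<comment> \<open>The induction hypothesis for the functional \<open>B g\<close> yields the
      projection \<open>q\<close> of \<open>g\<close> onto the span of \<open>G\<close>; this is why
      \<open>f\<close> is generalized in the induction.\<close>
    obtain q where q: "q \<in> V.span G" "\<And>v. v \<in> V.span G \<Longrightarrow> B q v = B g v"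
      using insert.IH[of "B g"] insert.prems(1) gX B_add B_scale B_sym X
      by (metis (no_types, lifting) V.subspace_add V.subspace_scale insert_subset)
    define g' where "g' = g - q"
    have pX: "p \<in> X" and qX: "q \<in> X" and g'X: "g' \<in> X"
      using p(1) q(1) GX gX V.subspace_diff[OF X] by (auto simp: g'_def)
    have orth: "B g' v = 0" if "v \<in> V.span G" for v
    proof -
      have "B g v = B (g' + q) v"
        by (simp add: g'_def)
      also have "\<dots> = B g' v + B g v"
        using that GX qX g'X q(2)[OF that] by (subst B_add) auto
      finally show ?thesis by simp
    qed
    show ?case
    proof (cases "g' = 0")
      case True
      then have "V.span (insert g G) = V.span G"
        using q(1) by (simp add: g'_def V.span_redundant)
      then show ?thesis
        using p by blast
    next
      case False
      then have nz: "B g' g' \<noteq> 0"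
        using B_pos g'X by blast
      \<comment> \<open>Since \<open>p\<close> is orthogonal to \<open>g'\<close>, the correction
        along \<open>g'\<close> alone must produce the value \<open>f g'\<close>.\<close>
      define k where "k = f g' / B g' g'"
      have sub: "V.span G \<subseteq> V.span (insert g G)"
        by (intro V.span_mono) auto
      have "g' \<in> V.span (insert g G)"
        using sub q(1) by (auto simp: g'_def intro: V.span_diff V.span_base)
      then have mem: "p + scale k g' \<in> V.span (insert g G)"
        using sub p(1) by (intro V.span_add V.span_scale) auto
      have "B (p + scale k g') v = f v" if v: "v \<in> V.span (insert g G)" for v
      proof -
        obtain c where c: "v - scale c g \<in> V.span G"
          using v unfolding V.span_insert by blast
        \<comment> \<open>This splits \<open>v\<close> into \<open>scale c g'\<close>, orthogonal to
          the span of \<open>G\<close>, and \<open>w\<close> inside that span.\<close>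
        define w where "w = v - scale c g + scale c q"
        have w: "w \<in> V.span G"
          unfolding w_def using c q(1) by (intro V.span_add V.span_scale)
        then have wX: "w \<in> X" using GX by blast
        have v_eq: "v = scale c g' + w"
          by (simp add: w_def g'_def V.scale_right_diff_distrib)
        have X': "scale c g' \<in> X" "scale k g' \<in> X" "v \<in> X"
          using wX g'X X by (auto simp: v_eq intro: V.subspace_add V.subspace_scale)
        have B1: "B y v = c * B y g' + B y w" if "y \<in> X" for y
          using that X' wX g'X by (simp add: B_sym[of y] v_eq B_add B_scale V.subspace_add[OF X])
        have "B (p + scale k g') v = B p v + k * B g' v"
          using pX g'X X' by (simp add: B_add B_scale)
        also have "\<dots> = f w + k * c * B g' g'"
          using B1[OF pX] B1[OF g'X] orth[OF w] orth[OF p(1)] B_sym[OF pX g'X] p(2)[OF w] by simp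
        also have "\<dots> = f w + c * f g'"
          using nz by (simp add: k_def)
        also have "\<dots> = f v"
          unfolding v_eq using insert.prems(2)[OF X'(1) wX] insert.prems(3)[OF g'X] by simp
        finally show ?thesis .
      qed
      then show ?thesis
        using mem by blast
    qed
  qed
qed

lemma orth_proj_unique:
  fixes S :: "'a::real_inner set"
  assumes "subspace S" "y \<in> S" "\<forall>z\<in>S. inner (x - y) z = 0"
  shows "orth_proj S x = y"
  unfolding orth_proj_def
proof (rule the_equality)
  fix y' assume y': "y' \<in> S \<and> (\<forall>z\<in>S. inner (x - y') z = 0)"
  have "y - y' \<in> S"
    using assms y' by (intro subspace_diff) auto
  then have "inner (x - y') (y - y') - inner (x - y) (y - y') = 0"
    using assms y' by simp
  then have "inner (y - y') (y - y') = 0"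
    by (simp add: inner_diff_left)
  then show "y' = y"
    by simp
qed (use assms in auto)

text \<open>Riesz representation of the functional \<open>inner x\<close> on \<open>S\<close> gives
  existence; with uniqueness, the \<open>THE\<close> in \<open>orth_proj\<close> denotes this
  vector.\<close>

lemma orth_proj_finite_dim:
  fixes S :: "'a::real_inner set"
  assumes "finite_dim_subspace S"
  shows "orth_proj S x \<in> S" and "\<And>z. z \<in> S \<Longrightarrow> inner (x - orth_proj S x) z = 0"
proof -
  obtain G where G: "finite G" "span G = S" and S: "subspace S"
    using assms unfolding finite_dim_subspace_def by blast
  have "\<exists>y\<in>module.span scaleR G. \<forall>v\<in>module.span scaleR G. inner y v = inner x v"
    by (rule riesz_on_span[OF real_vector.vector_space_axioms
          module.subspace_UNIV[OF real_vector.module_axioms] G(1)])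
      (auto simp: inner_add inner_commute)
  then obtain y where y: "y \<in> S" "\<And>v. v \<in> S \<Longrightarrow> inner y v = inner x v"
    using G(2) unfolding span_raw_def by blast
  then have "orth_proj S x = y"
    by (intro orth_proj_unique[OF S]) (auto simp: inner_diff_left)
  then show "orth_proj S x \<in> S" "\<And>z. z \<in> S \<Longrightarrow> inner (x - orth_proj S x) z = 0"
    using y by (auto simp: inner_diff_left)
qed

section \<open>Polynomials in time with coefficients in a subspace\<close>

lemma poly_space_add:
  assumes "subspace S" "p \<in> poly_space r S" "q \<in> poly_space r S"
  shows "(\<lambda>s. p s + q s) \<in> poly_space r S"
proof -
  obtain c d where "\<forall>i\<le>r. c i \<in> S" "p = (\<lambda>s. \<Sum>i\<le>r. s ^ i *\<^sub>R c i)" "\<forall>i\<le>r. d i \<in> S" "q = (\<lambda>s. \<Sum>i\<le>r. s ^ i *\<^sub>R d i)"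
    using assms unfolding poly_space_def by blast
  then show ?thesis
    unfolding poly_space_def using assms(1)
    by (intro CollectI exI[of _ "\<lambda>i. c i + d i"])
      (auto simp: scaleR_add_right sum.distrib intro: subspace_add)
qed

lemma poly_space_scale:
  assumes "subspace S" "p \<in> poly_space r S"
  shows "(\<lambda>s. k *\<^sub>R p s) \<in> poly_space r S"
proof -
  obtain c where "\<forall>i\<le>r. c i \<in> S" "p = (\<lambda>s. \<Sum>i\<le>r. s ^ i *\<^sub>R c i)"
    using assms unfolding poly_space_def by blast
  then show ?thesis
    unfolding poly_space_def using assms(1)
    by (intro CollectI exI[of _ "\<lambda>i. k *\<^sub>R c i"])
      (auto simp: scaleR_sum_right mult.commute intro: subspace_scale)
qed

lemma poly_space_diff:
  assumes "subspace S" "p \<in> poly_space r S" "q \<in> poly_space r S"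
  shows "(\<lambda>s. p s - q s) \<in> poly_space r S"
  using poly_space_add[OF assms(1,2) poly_space_scale[OF assms(1,3), of "-1"]] by simp

lemma poly_space_monom:
  assumes "subspace S" "i \<le> r" "v \<in> S"
  shows "(\<lambda>s. s ^ i *\<^sub>R v) \<in> poly_space r S"
proof -
  have "(\<Sum>j\<le>r. s ^ j *\<^sub>R (if j = i then v else 0)) = s ^ i *\<^sub>R v" for s :: real
  proof -
    have "(\<Sum>j\<le>r. s ^ j *\<^sub>R (if j = i then v else 0)) = (\<Sum>j\<le>r. if j = i then s ^ i *\<^sub>R v else 0)"
      by (intro sum.cong) auto
    then show ?thesis using assms(2) by simp
  qed
  then show ?thesis
    unfolding poly_space_def using assms
    by (intro CollectI exI[of _ "\<lambda>j. if j = i then v else 0"]) (auto simp: subspace_0)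
qed

lemma poly_space_const: "subspace S \<Longrightarrow> v \<in> S \<Longrightarrow> (\<lambda>_. v) \<in> poly_space r S"
  using poly_space_monom[of S 0 r v] by simp

lemma poly_space_continuous_on: 
  fixes S :: "'a::real_normed_vector set"
  shows "p \<in> poly_space r S \<Longrightarrow> continuous_on A p"
  unfolding poly_space_def by (auto intro!: continuous_intros)

lemma poly_space_has_vector_derivative:
  fixes S :: "'a::real_normed_vector set"
  assumes "p \<in> poly_space r S"
  shows "\<exists>p'. \<forall>s. (p has_vector_derivative p' s) (at s)"
proof -
  obtain c where p: "p = (\<lambda>s. \<Sum>i\<le>r. s ^ i *\<^sub>R c i)"
    using assms unfolding poly_space_def by blast
  have "(p has_vector_derivative (\<Sum>i\<le>r. (real i * s ^ (i - 1)) *\<^sub>R c i)) (at s)" for s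
    unfolding p by (auto intro!: derivative_eq_intros)
  then show ?thesis
    by (intro exI[of _ "\<lambda>s. \<Sum>i\<le>r. (real i * s ^ (i - 1)) *\<^sub>R c i"] allI)
qed

text \<open>The termwise primitive is taken because its values remain in \<open>S\<close>; this
  later puts the increment of the reconstruction into \<open>S j\<close>.\<close>

lemma poly_space_primitive:
  fixes S :: "'a::real_normed_vector set"
  assumes "p \<in> poly_space r S" and S: "subspace S"
  shows "\<exists>P. continuous_on UNIV P \<and> (\<forall>x. P x \<in> S) \<and> (\<forall>a x. a \<le> x \<longrightarrow> (p has_integral P x - P a) {a..x})"
proof -
  obtain c where c: "\<And>i. i \<le> r \<Longrightarrow> c i \<in> S" and p: "p = (\<lambda>s. \<Sum>i\<le>r. s ^ i *\<^sub>R c i)"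
    using assms unfolding poly_space_def by blast
  define P where "P x = (\<Sum>i\<le>r. (x ^ Suc i / real (Suc i)) *\<^sub>R c i)" for x
  have "(p has_integral P x - P a) {a..x}" if "a \<le> x" for a x
  proof -
    have "((\<lambda>s. s ^ i) has_integral x ^ Suc i / real (Suc i) - a ^ Suc i / real (Suc i)) {a..x}" for i
      using that by (intro fundamental_theorem_of_calculus)
        (auto intro!: derivative_eq_intros simp: has_real_derivative_iff_has_vector_derivative[symmetric] simp del: of_nat_Suc power_Suc)
    then have "(p has_integral (\<Sum>i\<le>r. (x ^ Suc i / real (Suc i) - a ^ Suc i / real (Suc i)) *\<^sub>R c i)) {a..x}"
      unfolding p by (intro has_integral_sum has_integral_scaleR_left) auto
    then show ?thesis
      by (simp add: P_def scaleR_left_diff_distrib sum_subtractf del: power_Suc of_nat_Suc)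
  qed
  moreover have "continuous_on UNIV P"
    unfolding P_def by (intro continuous_intros) auto
  moreover have "P x \<in> S" for x
    unfolding P_def using c by (intro subspace_sum subspace_scale S) auto
  ultimately show ?thesis by blast
qed

text \<open>The real polynomial \<open>inner (p s) (c i)\<close> has infinitely many zeros, so its
  coefficients vanish, and the i-th one is the squared norm of \<open>c i\<close>.\<close>

lemma poly_space_eq_0:
  fixes S :: "'a::real_inner set"
  assumes "p \<in> poly_space r S" "a < b" and z: "\<And>s. s \<in> {a..b} \<Longrightarrow> p s = 0"
  shows "p = (\<lambda>_. 0)"
proof -
  obtain c where p: "p = (\<lambda>s. \<Sum>i\<le>r. s ^ i *\<^sub>R c i)"
    using assms unfolding poly_space_def by blast
  have "c i = 0" if "i \<le> r" for i
  proof -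
    have "{a..b} \<subseteq> {s. (\<Sum>j\<le>r. inner (c j) (c i) * s ^ j) = 0}"
    proof safe
      fix s assume "s \<in> {a..b}"
      then have "inner (p s) (c i) = 0" by (simp add: z)
      then show "(\<Sum>j\<le>r. inner (c j) (c i) * s ^ j) = 0"
        by (simp add: p inner_sum_left mult.commute)
    qed
    then have "infinite {s. (\<Sum>j\<le>r. inner (c j) (c i) * s ^ j) = 0}"
      using \<open>a < b\<close> by (metis infinite_Icc finite_subset)
    then have "inner (c i) (c i) = 0"
      using polyfun_finite_roots[of "\<lambda>j. inner (c j) (c i)" r] that by blast
    then show ?thesis by simp
  qed
  then show ?thesis
    by (simp add: p)
qed

text \<open>Monomials with coefficients from a finite spanning set of \<open>S\<close> generate the
  space. Pointwise scaling is packaged as an explicit vector space, the form that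
  \<open>riesz_on_span\<close> takes.\<close>

lemma poly_space_spanned:
  fixes S :: "'a::real_vector set" and scale :: "real \<Rightarrow> (real \<Rightarrow> 'a) \<Rightarrow> real \<Rightarrow> 'a"
  assumes "finite_dim_subspace S"
  defines "scale \<equiv> \<lambda>k (f::real \<Rightarrow> 'a) s. k *\<^sub>R f s"
  shows "vector_space scale" "module.subspace scale (poly_space r S)"
    and "\<exists>G. finite G \<and> G \<subseteq> poly_space r S \<and> poly_space r S \<subseteq> module.span scale G"
proof -
  interpret V: vector_space scale
    by unfold_locales (auto simp: scale_def fun_eq_iff algebra_simps)
  show "vector_space scale" by (rule V.vector_space_axioms)
  obtain H where H: "finite H" "span H = S" and S: "subspace S"
    using assms unfolding finite_dim_subspace_def by blast
  show "V.subspace (poly_space r S)"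
    unfolding V.subspace_def
    using poly_space_const[OF S subspace_0[OF S]] poly_space_add[OF S] poly_space_scale[OF S]
    by (auto simp: scale_def zero_fun_def plus_fun_def)
  define G where "G = (\<lambda>(i, b) s. s ^ i *\<^sub>R b) ` ({..r} \<times> H)"
  have mono: "(\<lambda>s. s ^ i *\<^sub>R v) \<in> V.span G" if "i \<le> r" "v \<in> span H" for i v
    using that(2)
  proof (induction rule: span_induct)
    case base
    show ?case
      unfolding subspace_def
    proof (intro conjI ballI allI)
      show "0 \<in> {v. (\<lambda>s. s ^ i *\<^sub>R v) \<in> V.span G}"
        using V.span_zero[of G] by (simp add: zero_fun_def)
      fix x assume x: "x \<in> {v. (\<lambda>s. s ^ i *\<^sub>R v) \<in> V.span G}"
      show "c *\<^sub>R x \<in> {v. (\<lambda>s. s ^ i *\<^sub>R v) \<in> V.span G}" for c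
        using V.span_scale[of "\<lambda>s. s ^ i *\<^sub>R x" G c] x by (auto simp: scale_def mult.commute)
      fix y assume y: "y \<in> {v. (\<lambda>s. s ^ i *\<^sub>R v) \<in> V.span G}"
      show "x + y \<in> {v. (\<lambda>s. s ^ i *\<^sub>R v) \<in> V.span G}"
        using V.span_add[of _ G] x y by (auto simp: plus_fun_def scaleR_add_right)
    qed
  next
    case (step v)
    then have "(\<lambda>s. s ^ i *\<^sub>R v) \<in> G"
      unfolding G_def using that(1) by force
    then show ?case by (rule V.span_base)
  qed
  have "p \<in> V.span G" if pX: "p \<in> poly_space r S" for p
  proof -
    obtain c where c: "\<And>i. i \<le> r \<Longrightarrow> c i \<in> S" and p: "p = (\<lambda>s. \<Sum>i\<le>r. s ^ i *\<^sub>R c i)"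
      using pX unfolding poly_space_def by blast
    have "(\<Sum>i\<in>I. f i) s = (\<Sum>i\<in>I. f i s)" for f :: "nat \<Rightarrow> real \<Rightarrow> 'a" and I s
      by (induction I rule: infinite_finite_induct) auto
    then have "p = (\<Sum>i\<le>r. (\<lambda>s. s ^ i *\<^sub>R c i))"
      by (auto simp: p)
    also have "\<dots> \<in> V.span G"
      using c H by (intro V.span_sum mono) auto
    finally show ?thesis .
  qed
  moreover have "finite G"
    unfolding G_def using H by simp
  moreover have "G \<subseteq> poly_space r S"
    unfolding G_def using H S by (auto intro!: poly_space_monom span_base)
  ultimately show "\<exists>G. finite G \<and> G \<subseteq> poly_space r S \<and> poly_space r S \<subseteq> V.span G"
    by blast
qed

text \<open>Expanding \<open>V\<close> into monomials leaves powers of \<open>s\<close> times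
  \<open>inner (f s) (c i)\<close>, which is absolutely integrable thanks to the majorant
  \<open>h\<close>.\<close>

lemma inner_poly_integrable:
  fixes f :: "real \<Rightarrow> 'a::real_inner"
  assumes f: "f integrable_on {a..b}" and h: "h integrable_on {a..b}"
    and fh: "\<And>s. s \<in> {a..b} \<Longrightarrow> norm (f s) \<le> h s" and V: "V \<in> poly_space r S"
  shows "(\<lambda>s. inner (f s) (V s)) integrable_on {a..b}"
proof -
  obtain c where p: "V = (\<lambda>s. \<Sum>i\<le>r. s ^ i *\<^sub>R c i)"
    using V unfolding poly_space_def by blast
  have "(\<lambda>s. inner (f s) v) absolutely_integrable_on {a..b}" for v
  proof (rule absolutely_integrable_integrable_bound)
    show "(\<lambda>s. inner (f s) v) integrable_on {a..b}"
      using has_integral_inner_left_vec[OF integrable_integral[OF f], of v] by blast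
    show "(\<lambda>s. h s * norm v) integrable_on {a..b}"
      using h by (rule integrable_on_mult_left)
    show "norm (inner (f s) v) \<le> h s * norm v" if "s \<in> {a..b}" for s
      using Cauchy_Schwarz_ineq2[of "f s" v] mult_right_mono[OF fh[OF that] norm_ge_zero[of v]] by simp
  qed
  then have "(\<lambda>s. inner (f s) (c i) * s ^ i) integrable_on {a..b}" for i
    by (intro integrable_on_mult_continuous continuous_intros)
  then have "(\<lambda>s. \<Sum>i\<le>r. inner (f s) (c i) * s ^ i) integrable_on {a..b}"
    by (intro integrable_sum) auto
  then show ?thesis
    by (simp add: p inner_sum_right mult.commute)
qed

text \<open>The Riesz argument for the L2 product, which is definite because a polynomial vanishing
  on an interval is zero on the whole line; the same fact makes the \<open>THE\<close> unique.
  \<open>f\<close> is only required to be integrable against polynomials, since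
  \<open>F s (U s)\<close> is L^1 but possibly not L^2 in time.\<close>

lemma L2_poly_proj_finite_dim:
  fixes f :: "real \<Rightarrow> 'a::real_inner"
  assumes "a < b" and fin: "finite_dim_subspace S"
    and f: "\<And>V. V \<in> poly_space r S \<Longrightarrow> (\<lambda>s. inner (f s) (V s)) integrable_on {a..b}"
  shows "L2_poly_proj r {a<..<b} S f \<in> poly_space r S"
    and "V \<in> poly_space r S \<Longrightarrow>
      integral {a..b} (\<lambda>s. inner (L2_poly_proj r {a<..<b} S f s) (V s)) = integral {a..b} (\<lambda>s. inner (f s) (V s))"
proof -
  have S: "subspace S" using fin unfolding finite_dim_subspace_def by blast
  let ?X = "poly_space r S"
  let ?sc = "\<lambda>k (f::real \<Rightarrow> 'a) s. k *\<^sub>R f s"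
  let ?B = "\<lambda>p q. integral {a..b} (\<lambda>s. inner (p s) (q s))"
  have pp: "(\<lambda>s. inner (p s) (q s)) integrable_on {a..b}" if "p \<in> ?X" "q \<in> ?X" for p q
    using that by (intro integrable_continuous_real continuous_intros poly_space_continuous_on)
  have pos: "p = (\<lambda>_. 0)" if p: "p \<in> ?X" "?B p p = 0" for p
  proof -
    have "\<forall>s\<in>{a..b}. inner (p s) (p s) = 0"
      using p \<open>a < b\<close>
      by (subst integral_eq_0_iff[symmetric]) (auto intro!: continuous_intros poly_space_continuous_on[OF p(1)])
    then show ?thesis
      using p \<open>a < b\<close> by (intro poly_space_eq_0[of p r S a b]) auto
  qed
  obtain G where G: "finite G" "G \<subseteq> ?X" "?X \<subseteq> module.span ?sc G"
    using poly_space_spanned(3)[OF fin] by blast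
  have "\<exists>p\<in>module.span ?sc G. \<forall>v\<in>module.span ?sc G. ?B p v = integral {a..b} (\<lambda>s. inner (f s) (v s))"
  proof (rule riesz_on_span[OF poly_space_spanned(1,2)[OF fin] G(1,2)])
    show "?B x y = ?B y x" for x y :: "real \<Rightarrow> 'a"
      by (simp add: inner_commute)
    show "x = 0" if "x \<in> ?X" "?B x x = 0" for x
      using pos[OF that] by (simp add: zero_fun_def)
  qed (auto simp: inner_add_left inner_add_right integral_add pp f)
  moreover have "module.span ?sc G = ?X"
    using G poly_space_spanned(1,2)[OF fin]
    by (intro antisym module.span_minimal) (auto simp: module_iff_vector_space)
  ultimately obtain p where p: "p \<in> ?X" "\<And>V. V \<in> ?X \<Longrightarrow> ?B p V = integral {a..b} (\<lambda>s. inner (f s) (V s))"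
    by auto
  have diff: "integral {a<..<b} (\<lambda>s. inner (q s - f s) (V s)) = ?B q V - integral {a..b} (\<lambda>s. inner (f s) (V s))"
    if "q \<in> ?X" "V \<in> ?X" for q V
    using that by (simp add: inner_diff_left integral_diff pp f flip: integral_open_interval_real)
  have "L2_poly_proj r {a<..<b} S f = p"
    unfolding L2_poly_proj_def
  proof (rule the_equality)
    show "p \<in> ?X \<and> (\<forall>V\<in>?X. integral {a<..<b} (\<lambda>s. inner (p s - f s) (V s)) = 0)"
      using p by (auto simp: diff)
    fix q assume q: "q \<in> ?X \<and> (\<forall>V\<in>?X. integral {a<..<b} (\<lambda>s. inner (q s - f s) (V s)) = 0)"
    let ?d = "\<lambda>s. q s - p s"
    have d: "?d \<in> ?X"
      using q p(1) by (intro poly_space_diff[OF S]) auto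
    have "?B ?d ?d = ?B q ?d - ?B p ?d"
      using q p(1) d by (simp add: inner_diff_left integral_diff pp)
    also have "\<dots> = 0"
      using q d diff[of q ?d] p(2)[OF d] by auto
    finally have "?d = (\<lambda>_. 0)"
      using pos d by blast
    then show "q = p"
      by (simp add: fun_eq_iff)
  qed
  then show "L2_poly_proj r {a<..<b} S f \<in> ?X"
    "V \<in> ?X \<Longrightarrow> ?B (L2_poly_proj r {a<..<b} S f) V = integral {a..b} (\<lambda>s. inner (f s) (V s))"
    using p by auto
qed

section \<open>The reconstruction and its error\<close>

lemma Lim_at_endpoints:
  fixes p :: "real \<Rightarrow> 'a::t2_space"
  assumes "a < b" and p: "continuous_on UNIV p" and U: "\<And>s. s \<in> {a<..<b} \<Longrightarrow> U s = p s"
  shows "Lim (at_left b) U = p b" and "Lim (at_right a) U = p a"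
proof -
  have lim: "(p \<longlongrightarrow> p x) (at x within A)" for x A
    using p by (simp add: continuous_on_def tendsto_within_subset[OF _ subset_UNIV])
  have "(U \<longlongrightarrow> p b) (at_left b)"
    by (rule Lim_transform_eventually[OF lim])
      (use eventually_at_left_real[OF \<open>a < b\<close>] in \<open>eventually_elim, simp add: U\<close>)
  then show "Lim (at_left b) U = p b"
    by (intro tendsto_Lim) auto
  have "(U \<longlongrightarrow> p a) (at_right a)"
    by (rule Lim_transform_eventually[OF lim])
      (use eventually_at_right_real[OF \<open>a < b\<close>] in \<open>eventually_elim, simp add: U\<close>)
  then show "Lim (at_right a) U = p a"
    by (intro tendsto_Lim) auto
qed

lemma time_partition_bounds:
  assumes "time_partition T M t" "1 \<le> j" "j \<le> M"
  shows "0 \<le> t (j - 1)" "t (j - 1) < t j" "t j \<le> T"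
proof -
  have step: "t i < t (Suc i)" if "i < M" for i
    using assms that unfolding time_partition_def by blast
  have mono: "t i \<le> t k" if "i \<le> k" "k \<le> M" for i k
    using that
  proof (induction rule: dec_induct)
    case (step n)
    then show ?case using step(3) \<open>\<And>i. i < M \<Longrightarrow> t i < t (Suc i)\<close>[of n] by simp
  qed simp
  show "0 \<le> t (j - 1)" "t j \<le> T"
    using mono[of 0 "j - 1"] mono[of j M] assms unfolding time_partition_def by auto
  show "t (j - 1) < t j"
    using step[of "j - 1"] assms by simp
qed

text \<open>If the bound failed at \<open>x\<close>, continuity would make it fail on a nonempty
  open interval, which is not a null set. Thus \<open>eta_res\<close> controls the residual at every
  point, endpoints included.\<close>

lemma Linf_norm_le_continuous:
  fixes f :: "real \<Rightarrow> 'a::real_normed_vector"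
  assumes "a < b" and f: "continuous_on {a..b} f" and le: "Linf_norm {a<..<b} f \<le> ereal c" and x: "x \<in> {a..b}"
  shows "norm (f x) \<le> c"
proof (rule ccontr)
  assume "\<not> norm (f x) \<le> c"
  then obtain e where "e > 0" and e: "c + e \<le> norm (f x)"
    by (metis add.commute diff_add_cancel diff_gt_0_iff_gt less_eq_real_def not_le)
  obtain d where "d > 0" and d: "\<And>y. y \<in> {a..b} \<Longrightarrow> dist y x < d \<Longrightarrow> dist (f y) (f x) < e"
    using f x \<open>e > 0\<close> unfolding continuous_on_iff by metis
  have "AE y in lebesgue_on {a<..<b}. ereal (norm (f y)) \<le> ereal c"
    using esssup_AE[of "\<lambda>y. ereal (norm (f y))" "lebesgue_on {a<..<b}"]
    by eventually_elim (rule order_trans[OF _ le[unfolded Linf_norm_def]])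
  then obtain N where N: "N \<in> null_sets (lebesgue_on {a<..<b})" "\<And>y. y \<in> {a<..<b} - N \<Longrightarrow> norm (f y) \<le> c"
    by (auto elim!: AE_E3)
  \<comment> \<open>Cut down to \<open>{a<..<b}\<close>, where the norm is taken; nonempty even if
    \<open>x\<close> is an endpoint.\<close>
  define J where "J = {max a (x - d)<..<min b (x + d)}"
  have "y \<in> N" if "y \<in> J" for y
  proof (rule ccontr)
    assume "y \<notin> N"
    then have "norm (f y) \<le> c"
      using that by (intro N(2)) (auto simp: J_def)
    moreover have "dist (f y) (f x) < e"
      using that by (intro d) (auto simp: J_def dist_real_def abs_if)
    ultimately show False
      using e norm_triangle_ineq2[of "f x" "f y"] by (simp add: dist_norm norm_minus_commute)
  qed
  moreover have "negligible N"
    using N(1) by (simp add: negligible_iff_null_sets null_sets_restrict_space)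
  ultimately have "negligible J"
    by (meson negligible_subset subsetI)
  moreover have "max a (x - d) < min b (x + d)"
    using \<open>a < b\<close> \<open>d > 0\<close> x by auto
  then have "J \<noteq> {}"
    by (simp only: J_def greaterThanLessThan_empty_iff not_le not_False_eq_True)
  ultimately show False
    using open_not_negligible[of J] by (simp add: J_def)
qed

lemma Linf_norm_le:
  fixes f :: "real \<Rightarrow> 'a::real_normed_vector"
  assumes f: "continuous_on {a<..<b} f" and le: "\<And>x. x \<in> {a<..<b} \<Longrightarrow> norm (f x) \<le> c"
  shows "Linf_norm {a<..<b} f \<le> ereal c"
  unfolding Linf_norm_def
proof (rule esssup_I)
  have "(\<lambda>x. norm (f x)) \<in> borel_measurable (lebesgue_on {a<..<b})"
    using f by (intro continuous_imp_measurable_on_sets_lebesgue continuous_on_norm) auto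
  then show "(\<lambda>x. ereal (norm (f x))) \<in> borel_measurable (lebesgue_on {a<..<b})"
    by (rule borel_measurable_ereal)
  show "AE x in lebesgue_on {a<..<b}. ereal (norm (f x)) \<le> ereal c"
    using le by (intro AE_I2) simp
qed

lemma L2_poly_proj_cong:
  assumes "\<And>s. s \<in> I \<Longrightarrow> f s = g s"
  shows "L2_poly_proj r I S f = L2_poly_proj r I S g"
proof -
  have "integral I (\<lambda>s. inner (p s - f s) (V s)) = integral I (\<lambda>s. inner (p s - g s) (V s))" for p V
    by (intro integral_cong) (simp add: assms)
  then show ?thesis
    unfolding L2_poly_proj_def by simp
qed

lemma poly_space_mem: "subspace S \<Longrightarrow> p \<in> poly_space r S \<Longrightarrow> p s \<in> S"
  unfolding poly_space_def by (auto intro!: subspace_sum subspace_scale)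

context
  fixes T :: real
    and F :: "real \<Rightarrow> 'a::{real_inner,complete_space} \<Rightarrow> 'a"
    and L :: "real \<Rightarrow> real \<Rightarrow> real \<Rightarrow> real"
  assumes data: "local_lipschitz_data T F L"
begin

text \<open>\<open>U\<close> is replaced by its polynomial \<open>p\<close>, which is continuous up
  to the nodes, so that \<open>F s (p s)\<close> is integrable and the L2 projection exists. Testing
  the projection with constants expresses the increment \<open>y\<close> through the right-hand side
  of the scheme.\<close>

lemma reconstruction_on_interval:
  fixes t :: "nat \<Rightarrow> real" and S :: "nat \<Rightarrow> 'a set"
  assumes t: "0 \<le> t (j - 1)" "t (j - 1) < t j" "t j \<le> T" and fin: "finite_dim_subspace (S j)"
    and p: "p \<in> poly_space (r j) (S j)" and U: "\<And>s. s \<in> time_interval t j \<Longrightarrow> U s = p s"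
  shows "continuous_on {t (j - 1)..t j} (reconstruction F u0 t r S U j)"
    and "\<exists>y\<in>S j. reconstruction F u0 t r S U j (t j) = orth_proj (S j) (left_value u0 t U (j - 1)) + y \<and>
      (\<forall>v\<in>S j. inner y v = integral (time_interval t j) (\<lambda>s. inner (F s (U s)) v))"
proof -
  let ?a = "t (j - 1)" and ?b = "t j"
  let ?\<pi> = "orth_proj (S j) (left_value u0 t U (j - 1))"
  let ?f = "\<lambda>s. F s (p s)"
  have S: "subspace (S j)" using fin unfolding finite_dim_subspace_def by blast
  define P where "P = L2_poly_proj (r j) {?a<..<?b} (S j) ?f"
  have P_eq: "L2_poly_proj (r j) (time_interval t j) (S j) (\<lambda>s. F s (U s)) = P"
    unfolding P_def time_interval_def
    by (rule L2_poly_proj_cong) (use U in \<open>simp add: time_interval_def\<close>)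
  have cont: "continuous_on {?a..?b} p"
    by (rule poly_space_continuous_on[OF p])
  obtain K where K: "\<And>s. s \<in> {?a..?b} \<Longrightarrow> norm (p s) \<le> K"
    using continuous_on_Icc_norm_boundE[OF cont] by blast
  then have "0 \<le> K"
    using order_trans[OF norm_ge_zero K[of ?a]] t(2) by simp
  have int: "(\<lambda>s. inner (?f s) (V s)) integrable_on {?a..?b}" if "V \<in> poly_space (r j) (S j)" for V
  proof (rule inner_poly_integrable[OF F_comp_integrable[OF data t(1,3) cont]
        norm_F_bound_integrable[OF data t(1,3) \<open>0 \<le> K\<close>] _ that])
    show "norm (?f s) \<le> norm (F s 0) + L s K 0 * K" if "s \<in> {?a..?b}" for s
      using that t K by (intro norm_F_le[OF data]) auto
  qed
  have P: "P \<in> poly_space (r j) (S j)"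
    unfolding P_def by (rule L2_poly_proj_finite_dim(1)[OF t(2) fin int])
  have P_int: "integral {?a..?b} (\<lambda>s. inner (P s) v) = integral {?a..?b} (\<lambda>s. inner (?f s) v)" if "v \<in> S j" for v
    using L2_poly_proj_finite_dim(2)[OF t(2) fin int poly_space_const[OF S that]] unfolding P_def by simp
  obtain Q where Q: "continuous_on UNIV Q" "\<And>x. Q x \<in> S j" "\<And>a x. a \<le> x \<Longrightarrow> (P has_integral Q x - Q a) {a..x}"
    using poly_space_primitive[OF P S] by blast
  have rec: "reconstruction F u0 t r S U j x = ?\<pi> + (Q x - Q ?a)" if "?a \<le> x" for x
    unfolding reconstruction_def P_eq using integral_unique[OF Q(3)[OF that]] by simp
  have "continuous_on {?a..?b} (\<lambda>x. ?\<pi> + (Q x - Q ?a))"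
    by (intro continuous_intros continuous_on_subset[OF Q(1)]) auto
  then show "continuous_on {?a..?b} (reconstruction F u0 t r S U j)"
    by (rule continuous_on_eq) (simp add: rec)
  have "inner (Q ?b - Q ?a) v = integral (time_interval t j) (\<lambda>s. inner (F s (U s)) v)" if "v \<in> S j" for v
  proof -
    have "inner (Q ?b - Q ?a) v = integral {?a..?b} (\<lambda>s. inner (P s) v)"
      using has_integral_inner_left_vec[OF Q(3)] t(2) by (intro integral_unique[symmetric]) simp
    also have "\<dots> = integral {?a<..<?b} (\<lambda>s. inner (?f s) v)"
      unfolding P_int[OF that] by (rule integral_open_interval_real)
    also have "\<dots> = integral (time_interval t j) (\<lambda>s. inner (F s (U s)) v)"
      unfolding time_interval_def by (intro integral_cong) (use U in \<open>simp add: time_interval_def\<close>)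
    finally show ?thesis .
  qed
  then show "\<exists>y\<in>S j. reconstruction F u0 t r S U j (t j) = ?\<pi> + y \<and>
      (\<forall>v\<in>S j. inner y v = integral (time_interval t j) (\<lambda>s. inner (F s (U s)) v))"
    using rec[of ?b] t(2) Q(2) S by (intro bexI[of _ "Q ?b - Q ?a"]) (auto intro: subspace_diff)
qed

text \<open>Both schemes admit constant test functions; this is where \<open>r \<ge> 1\<close> is needed for cG.\<close>
lemma reconstruction_right_endpoint:
  fixes t :: "nat \<Rightarrow> real" and S :: "nat \<Rightarrow> 'a set"
  assumes scheme: "cG_solution F u0 M t r S U \<or> dG_solution F u0 M t r S U" and j: "j \<in> {1..M}"
    and t: "0 \<le> t (j - 1)" "t (j - 1) < t j" "t j \<le> T" and fin: "finite_dim_subspace (S j)"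
  shows "reconstruction F u0 t r S U j (t j) = left_value u0 t U j"
proof -
  let ?a = "t (j - 1)" and ?b = "t j"
  let ?l = "left_value u0 t U (j - 1)"
  have S: "subspace (S j)" using fin unfolding finite_dim_subspace_def by blast
  obtain p where p: "p \<in> poly_space (r j) (S j)" and U: "\<And>s. s \<in> time_interval t j \<Longrightarrow> U s = p s"
    using scheme j unfolding cG_solution_def dG_solution_def by metis
  have pc: "continuous_on UNIV p"
    by (rule poly_space_continuous_on[OF p])
  have lim: "Lim (at_left ?b) U = p ?b" "Lim (at_right ?a) U = p ?a"
    using Lim_at_endpoints[OF t(2) pc] U unfolding time_interval_def by auto
  have left: "left_value u0 t U j = p ?b" and right: "right_value t U (j - 1) = p ?a"
    using j lim by (auto simp: left_value_def right_value_def)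
  obtain y where y: "y \<in> S j" "reconstruction F u0 t r S U j ?b = orth_proj (S j) ?l + y"
    "\<And>v. v \<in> S j \<Longrightarrow> inner y v = integral (time_interval t j) (\<lambda>s. inner (F s (U s)) v)"
    using reconstruction_on_interval(2)[where t = t and S = S and j = j and r = r and U = U, OF t fin p U] by blast
  obtain p' where p': "\<And>s. (p has_vector_derivative p' s) (at s)"
    using poly_space_has_vector_derivative[OF p] by blast
  have deriv: "vector_derivative U (at s) = p' s" if "s \<in> time_interval t j" for s
  proof (rule vector_derivative_at)
    show "(U has_vector_derivative p' s) (at s)"
      by (rule has_vector_derivative_transform_within_open[OF p'[of s], of "time_interval t j"])
        (use that U in \<open>auto simp: time_interval_def\<close>)
  qed
  have ibp: "integral (time_interval t j) (\<lambda>s. inner (vector_derivative U (at s)) v) = inner (p ?b - p ?a) v" for v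
  proof -
    have "((\<lambda>s. inner (p' s) v) has_integral inner (p ?b) v - inner (p ?a) v) {?a..?b}"
      by (rule fundamental_theorem_of_calculus[OF less_imp_le[OF t(2)]
            bounded_linear.has_vector_derivative[OF bounded_linear_inner_left has_vector_derivative_at_within[OF p']]])
    then have "integral {?a<..<?b} (\<lambda>s. inner (p' s) v) = inner (p ?b - p ?a) v"
      unfolding integral_open_interval_real[symmetric] inner_diff_left by (rule integral_unique)
    moreover have "integral (time_interval t j) (\<lambda>s. inner (vector_derivative U (at s)) v) = integral {?a<..<?b} (\<lambda>s. inner (p' s) v)"
      using deriv unfolding time_interval_def by (intro integral_cong) simp
    ultimately show ?thesis by simp
  qed
  \<comment> \<open>For cG the initial condition says that \<open>p ?a\<close> is the projection of
    \<open>?l\<close>. For dG the jump term turns \<open>p ?a\<close> into \<open>?l\<close>, and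
    \<open>?l\<close> has the same product with \<open>v\<close> as its projection.\<close>
  have key: "inner (p ?b - orth_proj (S j) ?l) v = inner y v" if v: "v \<in> S j" for v
    using scheme
  proof
    assume cG: "cG_solution F u0 M t r S U"
    have test: "\<forall>V\<in>poly_space (r j - 1) (S j).
           integral (time_interval t j) (\<lambda>s. inner (vector_derivative U (at s)) (V s)) =
           integral (time_interval t j) (\<lambda>s. inner (F s (U s)) (V s))"
      and "right_value t U (j - 1) = orth_proj (S j) ?l"
      using cG j unfolding cG_solution_def by blast+
    moreover have "integral (time_interval t j) (\<lambda>s. inner (vector_derivative U (at s)) v) =
           integral (time_interval t j) (\<lambda>s. inner (F s (U s)) v)"
      by (rule bspec[OF test poly_space_const[OF S v]])
    ultimately show ?thesis
      unfolding ibp right y(3)[OF v] by simp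
  next
    assume dG: "dG_solution F u0 M t r S U"
    have *: "integral (time_interval t j) (\<lambda>s. inner (vector_derivative U (at s)) v) +
           inner (right_value t U (j - 1) - ?l) (right_value t (\<lambda>_. v) (j - 1)) =
           integral (time_interval t j) (\<lambda>s. inner (F s (U s)) v)"
      by (rule bspec[OF conjunct2[OF bspec[OF dG[unfolded dG_solution_def] j]] poly_space_const[OF S v]])
    have "right_value t (\<lambda>_. v) (j - 1) = v"
      unfolding right_value_def by (intro tendsto_Lim tendsto_const) simp
    then show ?thesis
      using * orth_proj_finite_dim(2)[OF fin v, of ?l] unfolding ibp right y(3)[OF v, symmetric]
      by (simp add: inner_diff_left)
  qed
  \<comment> \<open>\<open>?z\<close> lies in \<open>S j\<close>, so \<open>key\<close> can be
    tested with \<open>?z\<close> itself.\<close>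
  let ?z = "p ?b - orth_proj (S j) ?l - y"
  have "?z \<in> S j"
    using S y(1) orth_proj_finite_dim(1)[OF fin] poly_space_mem[OF S p]
    by (intro subspace_diff)
  then have "inner ?z ?z = 0"
    using key[of ?z] by (simp add: inner_diff_left)
  then have "p ?b = orth_proj (S j) ?l + y"
    by (simp only: inner_eq_zero_iff diff_diff_eq right_minus_eq)
  then show ?thesis
    by (simp only: y(2) left)
qed

text \<open>If the error has not exceeded \<open>d * \<psi>\<close> on an initial piece, then Gronwall's inequality
  and the choice of \<open>d\<close> give a strictly smaller bound there, so the level \<open>d * \<psi>\<close> is never
  reached. For \<open>\<psi> = 0\<close> the strictness is lost and Gronwall is applied with an a priori bound.\<close>
lemma error_le_of_lipschitz_integral:
  fixes u W :: "real \<Rightarrow> 'a"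
  assumes ab: "0 \<le> a" "a < b" "b \<le> T"
    and u: "continuous_on {a..b} u" and W: "continuous_on {a..b} W"
    and err: "\<And>x. x \<in> {a..b} \<Longrightarrow> norm (u x - W x) \<le>
      \<psi> + integral {a..x} (\<lambda>s. L s (norm (u s)) (norm (W s)) * norm (u s - W s))"
    and d: "1 < d" "exp (integral {a..b} (\<lambda>s. L s (d * \<psi> + norm (W s)) (norm (W s)))) < d"
    and x: "x \<in> {a..b}"
  shows "norm (u x - W x) \<le> d * \<psi>"
proof -
  define w where "w x = norm (u x - W x)" for x
  have w: "continuous_on {a..b} w"
    unfolding w_def using u W by (intro continuous_intros)
  have w0: "0 \<le> w x" for x
    by (simp add: w_def)
  have "w a \<le> \<psi>"
    using err[of a] ab by (simp add: w_def)
  then have "0 \<le> \<psi>"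
    using w0[of a] by simp
  have sub: "s \<in> {0..T}" if "s \<in> {a..b}" for s
    using that ab by auto
  \<comment> \<open>\<open>K\<close> stands for a bound on the error: then \<open>norm (u s)\<close>
    is at most \<open>K + norm (W s)\<close>, and by monotonicity \<open>l K s\<close> dominates the
    Lipschitz factor.\<close>
  define l where "l K s = L s (K + norm (W s)) (norm (W s))" for K s
  have l0: "0 \<le> l K s" if "s \<in> {a..b}" "0 \<le> K" for K s
    unfolding l_def using that by (intro lipschitz_constant_nonneg[OF data] sub) auto
  have l_int: "l K integrable_on {a..y}" if "y \<in> {a..b}" "0 \<le> K" for K y
    unfolding l_def using that ab
    by (intro lipschitz_constant_integrable_comp[OF data] continuous_intros continuous_on_subset[OF W]) auto
  have gron: "w y \<le> \<psi> * exp (integral {a..y} (l K))"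
    if y: "y \<in> {a..b}" and K: "\<And>s. s \<in> {a..y} \<Longrightarrow> w s \<le> K" for y K
  proof (rule gronwall_L1)
    have "0 \<le> K"
      using K[of a] y w0[of a] by simp
    show "a \<le> y" using y by simp
    show "continuous_on {a..y} w"
      using y by (intro continuous_on_subset[OF w]) auto
    show "l K integrable_on {a..y}"
      using y \<open>0 \<le> K\<close> by (rule l_int)
    show "0 \<le> l K s" if "s \<in> {a..y}" for s
      using that y \<open>0 \<le> K\<close> by (intro l0) auto
    fix z assume z: "z \<in> {a..y}"
    show "0 \<le> w z" by (rule w0)
    have c: "continuous_on {a..z} u" "continuous_on {a..z} W" "continuous_on {a..z} w"
      using y z by (auto intro: continuous_on_subset[OF u] continuous_on_subset[OF W] continuous_on_subset[OF w])
    have "w z \<le> \<psi> + integral {a..z} (\<lambda>s. L s (norm (u s)) (norm (W s)) * w s)"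
      using err[of z] y z unfolding w_def by simp
    also have "integral {a..z} (\<lambda>s. L s (norm (u s)) (norm (W s)) * w s) \<le> integral {a..z} (\<lambda>s. l K s * w s)"
    proof (rule integral_le)
      show "(\<lambda>s. L s (norm (u s)) (norm (W s)) * w s) integrable_on {a..z}"
        using y z ab c
        by (intro integrable_on_mult_continuous nonnegative_absolutely_integrable_1
            lipschitz_constant_integrable_comp[OF data] continuous_intros lipschitz_constant_nonneg[OF data]) auto
      show "(\<lambda>s. l K s * w s) integrable_on {a..z}"
        using y z c \<open>0 \<le> K\<close>
        by (intro integrable_on_mult_continuous nonnegative_absolutely_integrable_1 l_int l0) auto
      fix s assume s: "s \<in> {a..z}"
      have "norm (u s) \<le> K + norm (W s)"
        using norm_triangle_ineq2[of "u s" "W s"] K[of s] s z by (auto simp: w_def)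
      then have "L s (norm (u s)) (norm (W s)) \<le> l K s"
        unfolding l_def using s y z by (intro lipschitz_constant_mono[OF data] sub) auto
      then show "L s (norm (u s)) (norm (W s)) * w s \<le> l K s * w s"
        using w0 by (rule mult_right_mono)
    qed
    finally show "w z \<le> \<psi> + integral {a..z} (\<lambda>s. l K s * w s)" by simp
  qed
  have "w x \<le> d * \<psi>"
  proof (cases "\<psi> = 0")
    case True
    obtain K where "\<And>s. s \<in> {a..b} \<Longrightarrow> norm (w s) \<le> K"
      using continuous_on_Icc_norm_boundE[OF w] by blast
    then have "w x \<le> \<psi> * exp (integral {a..x} (l K))"
      using x w0 by (intro gron) auto
    then show ?thesis
      using True by simp
  next
    case False
    then have "0 < \<psi>" using \<open>0 \<le> \<psi>\<close> by simp
    show ?thesis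
    proof (rule ccontr)
      assume "\<not> w x \<le> d * \<psi>"
      have wa: "w a \<le> d * \<psi>"
        using \<open>w a \<le> \<psi>\<close> mult_right_mono[OF less_imp_le[OF d(1)] \<open>0 \<le> \<psi>\<close>] by linarith
      \<comment> \<open>The times at which the error equals the level. The intermediate value
        theorem makes \<open>Z\<close> nonempty and compactness gives a first such time
        \<open>z\<close>; an excess before \<open>z\<close> would produce an earlier one.\<close>
      define Z where "Z = {y \<in> {a..b}. w y = d * \<psi>}"
      have reach: "\<exists>z\<in>Z. z \<le> y" if y: "y \<in> {a..b}" "d * \<psi> \<le> w y" for y
        using IVT'[of w a "d * \<psi>" y] wa y continuous_on_subset[OF w, of "{a..y}"]
        unfolding Z_def by fastforce
      have "Z \<noteq> {}"
        using reach[OF x] \<open>\<not> w x \<le> d * \<psi>\<close> by auto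
      moreover have "compact Z"
        unfolding Z_def compact_eq_bounded_closed
        using continuous_closed_preimage_constant[OF w closed_atLeastAtMost, of "d * \<psi>"]
        by (auto intro: bounded_subset[of "{a..b}"])
      ultimately obtain z where z: "z \<in> Z" "\<And>y. y \<in> Z \<Longrightarrow> z \<le> y"
        using compact_attains_inf[of Z] by blast
      have zab: "z \<in> {a..b}" and wz: "w z = d * \<psi>"
        using z(1) by (auto simp: Z_def)
      have "w s \<le> d * \<psi>" if s: "s \<in> {a..z}" for s
      proof (rule ccontr)
        assume *: "\<not> w s \<le> d * \<psi>"
        then obtain y where "y \<in> Z" "y \<le> s"
          using reach[of s] s zab by auto
        then have "s = z"
          using z(2)[of y] s by simp
        then show False
          using * wz by simp
      qed
      then have "d * \<psi> \<le> \<psi> * exp (integral {a..z} (l (d * \<psi>)))"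
        using gron[OF zab, of "d * \<psi>"] wz by simp
      also have "\<dots> \<le> \<psi> * exp (integral {a..b} (l (d * \<psi>)))"
      proof -
        have "integral {a..z} (l (d * \<psi>)) \<le> integral {a..b} (l (d * \<psi>))"
          using zab ab d(1) \<open>0 < \<psi>\<close> by (intro integral_subset_le l_int l0 ballI) auto
        then show ?thesis
          using \<open>0 < \<psi>\<close> by simp
      qed
      also have "\<dots> < \<psi> * d"
        using d(2) \<open>0 < \<psi>\<close> unfolding l_def by simp
      finally show False by (simp add: mult.commute)
    qed
  qed
  then show ?thesis
    by (simp add: w_def)
qed

lemma norm_integral_F_diff_le:
  assumes ab: "0 \<le> a" "a \<le> x" "x \<le> T"
    and u: "continuous_on {a..x} u" and W: "continuous_on {a..x} W"
  shows "norm (integral {a..x} (\<lambda>s. F s (u s)) - integral {a..x} (\<lambda>s. F s (W s)))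
    \<le> integral {a..x} (\<lambda>s. L s (norm (u s)) (norm (W s)) * norm (u s - W s))"
proof -
  have i: "(\<lambda>s. F s (u s)) integrable_on {a..x}" "(\<lambda>s. F s (W s)) integrable_on {a..x}"
    using ab u W by (auto intro: F_comp_integrable[OF data])
  have "integral {a..x} (\<lambda>s. F s (u s)) - integral {a..x} (\<lambda>s. F s (W s)) = integral {a..x} (\<lambda>s. F s (u s) - F s (W s))"
    using i by (simp add: integral_diff)
  also have "norm \<dots> \<le> integral {a..x} (\<lambda>s. L s (norm (u s)) (norm (W s)) * norm (u s - W s))"
  proof (rule norm_integral_le_inner)
    show "(\<lambda>s. F s (u s) - F s (W s)) integrable_on {a..x}"
      using i by (rule integrable_diff)
    show "(\<lambda>s. L s (norm (u s)) (norm (W s)) * norm (u s - W s)) integrable_on {a..x}"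
      using ab u W
      by (intro integrable_on_mult_continuous nonnegative_absolutely_integrable_1
          lipschitz_constant_integrable_comp[OF data] continuous_intros lipschitz_constant_nonneg[OF data]) auto
    show "norm (F s (u s) - F s (W s)) \<le> L s (norm (u s)) (norm (W s)) * norm (u s - W s)" if "s \<in> {a..x}" for s
      using that ab by (intro lipschitz_bound[OF data]) auto
  qed
  finally show ?thesis .
qed

end

theorem theorem3p26:
  fixes T :: real
    and F :: "real \<Rightarrow> 'a::{real_inner,complete_space} \<Rightarrow> 'a"
    and L :: "real \<Rightarrow> real \<Rightarrow> real \<Rightarrow> real"
    and u0 :: 'a
    and u U :: "real \<Rightarrow> 'a"
    and M m :: nat
    and t :: "nat \<Rightarrow> real"
    and r :: "nat \<Rightarrow> nat"
    and S :: "nat \<Rightarrow> 'a set"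
    and \<psi> :: "nat \<Rightarrow> real"
    and Uhat e :: "nat \<Rightarrow> real \<Rightarrow> 'a"
  defines "Uhat \<equiv> reconstruction F u0 t r S U"
    and "e \<equiv> \<lambda>j s. u s - Uhat j s"
  assumes "T > 0"
    and "local_lipschitz_data T F L"
    and "ivp_solution T F u0 u"
    and "time_partition T M t"
    and "\<forall>j\<in>{1..M}. finite_dim_subspace (S j)"
    and "cG_solution F u0 M t r S U \<or> dG_solution F u0 M t r S U"
    and "ereal (\<psi> 1) \<ge> ereal (eta_proj u0 t S U 0) + eta_res F t Uhat 1"
    and "\<forall>j\<in>{2..M}. ereal (\<psi> j) \<ge>
           ereal (norm (e (j - 1) (t (j - 1)))) + ereal (eta_proj u0 t S U (j - 1)) + eta_res F t Uhat j"
    and "1 \<le> m" and "m \<le> M"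
    and "\<forall>j\<in>{1..m}. delta_set L t Uhat \<psi> j \<noteq> {}"
  shows "Linf_norm (time_interval t m) (e m) \<le> ereal (delta L t Uhat \<psi> m * \<psi> m)"
proof -
  note data = assms(4) and scheme = assms(8)
  define a where "a = t (m - 1)"
  define b where "b = t m"
  define W where "W = Uhat m"
  have ab: "0 \<le> a" "a < b" "b \<le> T"
    using time_partition_bounds[OF assms(6), of m] assms(11,12) by (auto simp: a_def b_def)
  have I: "time_interval t m = {a<..<b}"
    by (simp add: time_interval_def a_def b_def)
  have u: "continuous_on {0..T} u"
    and u_eq: "\<And>x. x \<in> {0..T} \<Longrightarrow> u x = u0 + integral {0..x} (\<lambda>s. F s (u s))"
    using assms(5) unfolding ivp_solution_def by auto
  have uab: "continuous_on {a..b} u"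
    using ab by (intro continuous_on_subset[OF u]) auto
  have fin: "finite_dim_subspace (S j)" if "j \<in> {1..M}" for j
    using assms(7) that by blast
  obtain p where p: "p \<in> poly_space (r m) (S m)" "\<And>s. s \<in> time_interval t m \<Longrightarrow> U s = p s"
    using scheme assms(11,12) unfolding cG_solution_def dG_solution_def by (metis atLeastAtMost_iff)
  have Wc: "continuous_on {a..b} W"
    using reconstruction_on_interval(1)[where t = t and S = S and j = m and r = r and U = U, OF data _ _ _ fin p]
      ab assms(11,12)
    by (simp add: W_def Uhat_def a_def b_def)
  have Wa: "W a = orth_proj (S m) (left_value u0 t U (m - 1))"
    by (simp add: W_def Uhat_def a_def reconstruction_def)
  \<comment> \<open>In \<open>ereal\<close> because \<open>eta_res\<close> could a priori be
    infinite. For m > 1 the error at \<open>a\<close> is the previous error plus the projection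
    jump, since the previous reconstruction ends at U(t_{m-1}^-).\<close>
  have start: "ereal (norm (u a - W a)) + eta_res F t Uhat m \<le> ereal (\<psi> m)"
  proof (cases "m = 1")
    \<comment> \<open>\<open>left_value\<close> at index 0 is \<open>u0\<close>, which is also the
      value of \<open>u\<close> there, so the initial error is exactly the projection error of
      \<open>u0\<close>.\<close>
    case True
    have "t 0 = 0" using assms(6) unfolding time_partition_def by blast
    then have "u a = u0"
      using u_eq[of 0] True \<open>T > 0\<close> by (simp add: a_def)
    then have "norm (u a - W a) = eta_proj u0 t S U 0"
      using True Wa by (simp add: eta_proj_def left_value_def)
    then show ?thesis
      using assms(9) True by simp
  next
    case False
    define x where "x = norm (e (m - 1) a)"
    define y where "y = eta_proj u0 t S U (m - 1)"
    have m1: "m - 1 \<in> {1..M}" "Suc (m - 1) = m"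
      using False assms(11,12) by auto
    have "Uhat (m - 1) a = left_value u0 t U (m - 1)"
      unfolding Uhat_def a_def
      using m1 time_partition_bounds[OF assms(6), of "m - 1"]
      by (intro reconstruction_right_endpoint[OF data scheme m1(1)] fin) auto
    then have "u a - W a = e (m - 1) a + (left_value u0 t U (m - 1) - orth_proj (S m) (left_value u0 t U (m - 1)))"
      unfolding e_def Wa by simp
    then have "norm (u a - W a) \<le> x + y"
      unfolding x_def y_def eta_proj_def m1(2) by (metis norm_triangle_ineq)
    then have "ereal (norm (u a - W a)) + eta_res F t Uhat m \<le> ereal (x + y) + eta_res F t Uhat m"
      by (intro add_right_mono) simp
    also have "\<dots> \<le> ereal (\<psi> m)"
      using assms(10) False assms(11,12) unfolding x_def y_def a_def by simp
    finally show ?thesis .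
  qed
  define R where "R = residual F t Uhat m"
  have R_eq: "R x = W a - W x + integral {a..x} (\<lambda>s. F s (W s))" for x
    by (simp add: R_def residual_def W_def a_def)
  have Rc: "continuous_on {a..b} R"
    unfolding R_eq[abs_def] using ab Wc
    by (intro continuous_intros F_comp_integral_continuous[OF data]) auto
  \<comment> \<open>The subtraction is legitimate: \<open>start\<close> excludes the value infinity
    for the residual norm.\<close>
  have "Linf_norm {a<..<b} R \<le> ereal (\<psi> m - norm (u a - W a))"
    using start unfolding eta_res_def I R_def
    by (cases "Linf_norm {a<..<b} (residual F t Uhat m)") auto
  then have Rb: "norm (u a - W a) + norm (R x) \<le> \<psi> m" if "x \<in> {a..b}" for x
    using Linf_norm_le_continuous[OF ab(2) Rc _ that] by fastforce
  have err: "norm (u x - W x) \<le> \<psi> m + integral {a..x} (\<lambda>s. L s (norm (u s)) (norm (W s)) * norm (u s - W s))"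
    if x: "x \<in> {a..b}" for x
  proof -
    have "u x = u a + integral {a..x} (\<lambda>s. F s (u s))"
      using u_eq[of x] u_eq[of a] F_comp_integral_combine[OF data, of 0 a x u] continuous_on_subset[OF u, of "{0..x}"] x ab
      by simp
    \<comment> \<open>Inserting the integral of \<open>F s (W s)\<close> isolates the residual; only
      the last difference needs the Lipschitz condition.\<close>
    then have "u x - W x = (u a - W a) + R x + (integral {a..x} (\<lambda>s. F s (u s)) - integral {a..x} (\<lambda>s. F s (W s)))"
      by (simp add: R_eq)
    also have "norm \<dots> \<le> norm (u a - W a) + norm (R x) + norm (integral {a..x} (\<lambda>s. F s (u s)) - integral {a..x} (\<lambda>s. F s (W s)))"
      by (intro norm_triangle_le add_mono norm_triangle_ineq order_refl)
    also have "\<dots> \<le> \<psi> m + integral {a..x} (\<lambda>s. L s (norm (u s)) (norm (W s)) * norm (u s - W s))"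
      using x ab by (intro add_mono Rb norm_integral_F_diff_le[OF data] continuous_on_subset[OF uab] continuous_on_subset[OF Wc]) auto
    finally show ?thesis .
  qed
  let ?D = "delta_set L t Uhat \<psi> m"
  have D: "?D \<noteq> {}"
    using assms(11,13) by auto
  have bound: "norm (u x - W x) \<le> d * \<psi> m" if "d \<in> ?D" "x \<in> {a..b}" for d x
  proof (rule error_le_of_lipschitz_integral[OF data ab uab Wc err _ _ that(2)])
    show "1 < d" "exp (integral {a..b} (\<lambda>s. L s (d * \<psi> m + norm (W s)) (norm (W s)))) < d"
      using that(1) unfolding delta_set_def phi_def I W_def by (auto simp: integral_open_interval_real)
  qed
  have "0 \<le> \<psi> m"
    using Rb[of a] ab norm_ge_zero[of "u a - W a"] norm_ge_zero[of "R a"] by (smt (verit) atLeastAtMost_iff)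
  \<comment> \<open>Passing to the infimum goes through division by \<open>\<psi> m\<close>; if that
    is 0, any element of \<open>?D\<close> already gives the claim.\<close>
  have "norm (u x - W x) \<le> Inf ?D * \<psi> m" if x: "x \<in> {a..b}" for x
  proof (cases "\<psi> m = 0")
    case True
    then show ?thesis using bound[OF _ x] D by auto
  next
    case False
    then have "0 < \<psi> m" using \<open>0 \<le> \<psi> m\<close> by simp
    then have "norm (u x - W x) / \<psi> m \<le> Inf ?D"
      using bound[OF _ x] by (intro cInf_greatest D) (simp add: divide_le_eq)
    then show ?thesis
      using \<open>0 < \<psi> m\<close> by (simp add: divide_le_eq)
  qed
  then have "Linf_norm {a<..<b} (\<lambda>s. u s - W s) \<le> ereal (Inf ?D * \<psi> m)"
    by (intro Linf_norm_le continuous_intros continuous_on_subset[OF uab] continuous_on_subset[OF Wc]) auto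
  then show ?thesis
    by (simp add: I e_def W_def delta_def)
qed

end
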